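(* Let $(\lambda,v)$ be a simple eigenpair of the nonlinear Hermitian eigenproblem $T(\lambda)v=0$, where $v$ is normalized such that $v^*T'(\lambda)v=1$. Assume that there exist $\delta>0$ and a corresponding $\xi>0$ such that for any eigenpair approximation $(\mu,x)$ with $\left\|\begin{bmatrix}x\\ \mu\end{bmatrix}-\begin{bmatrix}v\\ \lambda\end{bmatrix}\right\|\le\delta$ we have $\|T'(\mu)x\|\le\xi$. Let $x_k=\gamma_k(c_kv+s_kg_k)$ be the eigenvector approximation obtained in the $k$-th iteration of the PLMR method (with parameter $m_k$ in iteration $k$), where $\gamma_k$, $c_k$, $s_k$ are respectively the generalized norm of $x_k$ and the generalized cosine and sine of $\angle(x_k,v)$. Suppose that $\angle(x_0,v)$ is sufficiently small, such that $\left\|\begin{bmatrix}x_0\\ \rho(x_0)\end{bmatrix}-\begin{bmatrix}v\\ \lambda\end{bmatrix}\right\|\le\delta$. For each $x_k$, assume that the refined projection of PLMR extracts from the search subspace $\mathcal{U}_k^{\mathrm{PLMR}}$ a new eigenvector approximation $x_{k+1}$ such that $$\sin\angle(v,x_{k+1})\le C\,\sin\angle(v,\mathcal{U}_k^{\mathrm{PLMR}})$$ for a small constant $C$ independent of $k$. Assume that the Jacobi-Davidson correction equation $$\Pi_k\,T(\rho_k)\,\Pi_k^*\,\Delta x_k=-T(\rho_k)x_k$$ is solved by right-preconditioned GMRES($m_k$) with the preconditioner $M_{\Pi_k}=\Pi_kM\Pi_k^*$ (applied through $M_{\Pi_k}^{\dagger}$). Let $\tau_k^{(\alpha)}=\tau_0^{(\alpha)}$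 be a sufficiently small and fixed tolerance, and let $\tau_k^{(\beta)}\le C_\beta\frac{|s_k|}{|c_k|}$ and $\tau_k^{(\gamma)}\le C_\gamma\frac{|s_k|^2}{|c_k|^2}$ be decreasing sequences of tolerances, where $C_\beta$ and $C_\gamma$ are sufficiently small constants independent of $k$. For each $k$, assume that $m_k$ is sufficiently large, such that one cycle of GMRES($m_k$) delivers an approximate solution of the correction equation satisfying the relative tolerance $\tau_k^{(\alpha)}$, $\tau_k^{(\beta)}$ or $\tau_k^{(\gamma)}$, respectively. Then PLMR($m_k$) converges towards $(\lambda,v)$ at least linearly, quadratically or cubically, respectively.
   Context: **Eigenproblem.** $J=(a,b)\subset\mathbb{R}$ is a finite open interval, and $T(\cdot):J\to\mathbb{C}^{n\times n}$ is continuously differentiable with $T(\mu)$ Hermitian for every $\mu\in J$; $a,b$ are not eigenvalues of $T(\cdot)$. A scalar $\lambda\in J$ is an eigenvalue with eigenvector $v\neq0$ if $T(\lambda)v=0$; an eigenvalue is simple here if (in particular) $\dim\mathrm{null}\,T(\lambda)=1$. The Rayleigh functional $\rho:\mathbb{C}^n\setminus\{0\}\to J$ is the continuous map sending $x$ to the unique solution $\rho(x)\in J$ of $x^*T(\rho(x))x=0$. $J$ is assumed to be of definite type: $(\mu-\rho(x))\,(x^*T(\mu)x)$ is constantly positive, or constantly negative, for all $x\ne0$ and all $\mu\in J$ with $\mu\ne\rho(x)$. Write $\rho_k=\rho(x_k)$. **Generalized norm, sine, cosine.** Given $v$ with $v^*T'(\lambda)v=1$, every $x\ne0$ is decomposed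 as $x=\gamma(cv+sg)$, where $g$ satisfies $v^*T'(\lambda)g=0$ and $\|g\|=1$, and $|c|^2+|s|^2=1$, $\gamma>0$. Thus $\gamma c=v^*T'(\lambda)x$, $\gamma|s|=\|x-(v^*T'(\lambda)x)v\|$, and $|s|/|c|$ is a generalized tangent of $\angle(x,v)$. **Projector and stabilized preconditioner.** $M\approx T(\sigma)$ is a given nonsingular matrix, with $\sigma\in J$ a given shift; $\lambda$ is the eigenvalue of $T(\cdot)$ closest to $\sigma$. Define $$\Pi_k=I-\frac{T'(\rho_k)x_kx_k^*}{x_k^*T'(\rho_k)x_k},\qquad M_{\Pi_k}=\Pi_kM\Pi_k^*,$$ $$M_{\Pi_k}^{\dagger}b=\left(I-\frac{M^{-1}T'(\rho_k)x_k\,x_k^*T'(\rho_k)}{x_k^*T'(\rho_k)M^{-1}T'(\rho_k)x_k}\right)M^{-1}b,$$ the denominators being assumed nonzero. **PLMR($m$).** Here $\mathcal{K}_j(A,b)=\mathrm{span}\{b,Ab,\dots,A^{j-1}b\}$. Starting from $x_0$, set $p_{-1}=0$ and $p_{k-1}=x_k-x_{k-1}$ for $k\ge1$. Iteration $k$ with parameter $m=m_k$ uses the search subspace $$\mathcal{U}_k^{\mathrm{PLMR}}=\mathcal{K}_{m+1}\big(M_{\Pi_k}^{\dagger}T(\rho_k),x_k\big)+\mathrm{span}\{p_{k-1}\}.$$ Let $U_k$ have orthonormal columns spanning it. Refined projection: fix positive integers $r,s$. Solve $U_k^*T(\nu)U_ky=0$ for Ritz pairs $(\nu,U_ky)$.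 Among the $r$ Ritz values closest to $\sigma$, take the $s$ whose Ritz pairs $(\nu,z)$ have smallest relative residual $\|T(\nu)z\|_2/(\|T(\nu)\|_F\|z\|_2)$, and among these let $\nu_\ell$ be the closest to $\sigma$. Let $y_{MR}$ minimize $\|T(\nu_\ell)U_ky\|_2$ over $\|y\|=1$. Set $x_{k+1}=U_ky_{MR}$, scaled so that $x_{k+1}^*T'(\rho_{k+1})x_{k+1}=1$. **Right-preconditioned GMRES.** One cycle of right-preconditioned GMRES($m$) for the correction equation (zero initial guess) returns the residual-norm minimizer $\Delta x_k$ over $M_{\Pi_k}^{\dagger}\mathcal{K}_m\big(\Pi_kT(\rho_k)\Pi_k^*M_{\Pi_k}^{\dagger},T(\rho_k)x_k\big)$. It satisfies relative tolerance $\tau_k$ if $\|\Pi_kT(\rho_k)\Pi_k^*\Delta x_k+T(\rho_k)x_k\|\le\tau_k\|T(\rho_k)x_k\|$. The associated basic Jacobi-Davidson update would be $x_k+\Delta x_k$. **Convergence orders.** $\angle(v,\mathcal{U})$ is the angle between $v$ and the subspace $\mathcal{U}$. Convergence is measured by $\epsilon_k=\sin\angle(v,x_k)$: at least linearly, quadratically, cubically means $\epsilon_k\to0$ with, respectively, $\epsilon_{k+1}\le q\,\epsilon_k$ for some $q<1$, $\epsilon_{k+1}\le K\epsilon_k^2$, $\epsilon_{k+1}\le K\epsilon_k^3$, with constants independent of $k$.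
   Formalization: For the cubic claim only, T' is additionally assumed to satisfy a Hölder condition of exponent 1/2 at λ (automatic if T is twice differentiable there); with T merely continuously differentiable, cubic convergence can fail. *)

theory Defs
  imports "HOL-Analysis.Analysis"
begin

section \<open>Complex Euclidean space\<close>

text \<open>The number \<open>x\<^sup>* y\<close>; thus \<open>x\<^sup>* A y\<close> is \<open>cip x (A *v y)\<close>.\<close>

definition cip :: "complex ^ 'n \<Rightarrow> complex ^ 'n \<Rightarrow> complex" where
  "cip x y = (\<Sum>i\<in>UNIV. cnj (x $ i) * y $ i)"

text \<open>The rank-one matrix \<open>x y\<^sup>*\<close>.\<close>

definition outer :: "complex ^ 'n \<Rightarrow> complex ^ 'n \<Rightarrow> complex ^ 'n ^ 'n" where
  "outer x y = (\<chi> i j. x $ i * cnj (y $ j))"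

definition cadjoint :: "complex ^ 'n ^ 'm \<Rightarrow> complex ^ 'm ^ 'n" where
  "cadjoint A = (\<chi> i j. cnj (A $ j $ i))"

definition hermitian :: "complex ^ 'n ^ 'n \<Rightarrow> bool" where
  "hermitian A \<longleftrightarrow> cadjoint A = A"

text \<open>Angles are angles between complex lines, with values in \<open>[0, \<pi>/2]\<close>; the angle between a
  vector and a subspace is the smallest angle to a nonzero vector of the subspace.\<close>

definition vec_angle :: "complex ^ 'n \<Rightarrow> complex ^ 'n \<Rightarrow> real" where
  "vec_angle v x = arccos (cmod (cip v x) / (norm v * norm x))"

definition subspace_angle :: "complex ^ 'n \<Rightarrow> (complex ^ 'n) set \<Rightarrow> real" where
  "subspace_angle v U = (INF u\<in>U - {0}. vec_angle v u)"


section \<open>The nonlinear Hermitian eigenproblem\<close>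

text \<open>\<open>T'\<close> is the derivative of \<open>T\<close> on the interval.  Since \<open>T\<close> is a total function, the values
  at \<open>a\<close> and \<open>b\<close> exist; they are used only to say that \<open>a\<close> and \<open>b\<close> are not eigenvalues.\<close>

definition hermitian_nep ::
    "real \<Rightarrow> real \<Rightarrow> (real \<Rightarrow> complex ^ 'n ^ 'n) \<Rightarrow> (real \<Rightarrow> complex ^ 'n ^ 'n) \<Rightarrow> bool" where
  "hermitian_nep a b T T' \<longleftrightarrow>
     a < b \<and>
     (\<forall>\<mu>\<in>{a<..<b}. hermitian (T \<mu>)) \<and>
     (\<forall>\<mu>\<in>{a<..<b}. (T has_vector_derivative T' \<mu>) (at \<mu>)) \<and>
     continuous_on {a<..<b} T' \<and>
     \<not> (\<exists>w. w \<noteq> 0 \<and> T a *v w = 0) \<and> \<not> (\<exists>w. w \<noteq> 0 \<and> T b *v w = 0)"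

definition eigenpair :: "real \<Rightarrow> real \<Rightarrow> (real \<Rightarrow> complex ^ 'n ^ 'n) \<Rightarrow> real \<Rightarrow> complex ^ 'n \<Rightarrow> bool" where
  "eigenpair a b T \<mu> w \<longleftrightarrow> \<mu> \<in> {a<..<b} \<and> w \<noteq> 0 \<and> T \<mu> *v w = 0"

definition simple_eigenpair ::
    "real \<Rightarrow> real \<Rightarrow> (real \<Rightarrow> complex ^ 'n ^ 'n) \<Rightarrow> real \<Rightarrow> complex ^ 'n \<Rightarrow> bool" where
  "simple_eigenpair a b T \<mu> w \<longleftrightarrow> eigenpair a b T \<mu> w \<and> vec.dim {u. T \<mu> *v u = 0} = 1"

definition rayleigh_functional ::
    "real \<Rightarrow> real \<Rightarrow> (real \<Rightarrow> complex ^ 'n ^ 'n) \<Rightarrow> (complex ^ 'n \<Rightarrow> real) \<Rightarrow> bool" where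
  "rayleigh_functional a b T \<rho> \<longleftrightarrow>
     continuous_on (- {0}) \<rho> \<and>
     (\<forall>x. x \<noteq> 0 \<longrightarrow> \<rho> x \<in> {a<..<b} \<and> cip x (T (\<rho> x) *v x) = 0 \<and>
            (\<forall>\<mu>\<in>{a<..<b}. cip x (T \<mu> *v x) = 0 \<longrightarrow> \<mu> = \<rho> x))"

text \<open>The form \<open>x\<^sup>* T(\<mu>) x\<close> is real because \<open>T(\<mu>)\<close> is Hermitian.\<close>

definition definite_type ::
    "real \<Rightarrow> real \<Rightarrow> (real \<Rightarrow> complex ^ 'n ^ 'n) \<Rightarrow> (complex ^ 'n \<Rightarrow> real) \<Rightarrow> bool" where
  "definite_type a b T \<rho> \<longleftrightarrow>
     (\<forall>x \<mu>. x \<noteq> 0 \<and> \<mu> \<in> {a<..<b} \<and> \<mu> \<noteq> \<rho> x \<longrightarrow> (\<mu> - \<rho> x) * Re (cip x (T \<mu> *v x)) > 0) \<or>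
     (\<forall>x \<mu>. x \<noteq> 0 \<and> \<mu> \<in> {a<..<b} \<and> \<mu> \<noteq> \<rho> x \<longrightarrow> (\<mu> - \<rho> x) * Re (cip x (T \<mu> *v x)) < 0)"

text \<open>Regularity of the derivative \<open>T'\<close> at the eigenvalue \<open>\<lambda>\<close> beyond continuity: a Hoelder condition with exponent
  \<open>1/2\<close>, satisfied by every twice differentiable \<open>T\<close>.  It is needed for cubic convergence only.
  If \<open>T'\<close> is merely continuous then \<open>T'(\<rho>\<^sub>k) - T'(\<lambda>)\<close> is \<open>o(1)\<close>, whereas \<open>\<rho>\<^sub>k - \<lambda> = O(\<epsilon>\<^sub>k\<^sup>2)\<close>, and even
  the exact solution of the correction equation yields an error of order \<open>o(\<epsilon>\<^sub>k\<^sup>2)\<close>, which need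
  not be \<open>O(\<epsilon>\<^sub>k\<^sup>3)\<close>.\<close>

definition half_hoelder_at :: "(real \<Rightarrow> complex ^ 'n ^ 'n) \<Rightarrow> real \<Rightarrow> bool" where
  "half_hoelder_at T' l \<longleftrightarrow>
     (\<exists>L. \<forall>\<^sub>F \<mu> in at l. norm (T' \<mu> - T' l) \<le> L * sqrt \<bar>\<mu> - l\<bar>)"

text \<open>Decomposition of \<open>x\<close> into generalized norm, cosine and sine relative to \<open>v\<close>, where \<open>B\<close>
  stands for \<open>T'(\<lambda>)\<close>.\<close>

definition generalized_decomp ::
    "complex ^ 'n ^ 'n \<Rightarrow> complex ^ 'n \<Rightarrow> complex ^ 'n \<Rightarrow> real \<Rightarrow> complex \<Rightarrow> complex \<Rightarrow> complex ^ 'n \<Rightarrow> bool" where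
  "generalized_decomp B v x \<gamma> c s g \<longleftrightarrow>
     \<gamma> > 0 \<and> x = \<gamma> *\<^sub>R (c *s v + s *s g) \<and>
     cip v (B *v g) = 0 \<and> norm g = 1 \<and> (cmod c)\<^sup>2 + (cmod s)\<^sup>2 = 1"


section \<open>Krylov subspaces, projector, preconditioner, GMRES\<close>

definition krylov :: "nat \<Rightarrow> complex ^ 'n ^ 'n \<Rightarrow> complex ^ 'n \<Rightarrow> (complex ^ 'n) set" where
  "krylov j A b = vec.span ((\<lambda>i. (((*v) A) ^^ i) b) ` {..<j})"

text \<open>\<open>stab_prec M D x\<close> is the stabilized inverse action of the preconditioner \<open>\<Pi> M \<Pi>\<^sup>*\<close>, where
  \<open>\<Pi>\<close> is \<open>jd_proj D x\<close>.  In the next definitions \<open>D\<close> stands for \<open>T'(\<rho>\<^sub>k)\<close> and \<open>A\<close> for \<open>T(\<rho>\<^sub>k)\<close>; the factor \<open>mat c\<close>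
  is multiplication by the scalar \<open>c\<close>, and \<open>outer y x ** D\<close> is \<open>y (x\<^sup>* D)\<close>.\<close>

definition jd_proj :: "complex ^ 'n ^ 'n \<Rightarrow> complex ^ 'n \<Rightarrow> complex ^ 'n ^ 'n" where
  "jd_proj D x = mat 1 - mat (1 / cip x (D *v x)) ** outer (D *v x) x"

definition stab_prec ::
    "complex ^ 'n ^ 'n \<Rightarrow> complex ^ 'n ^ 'n \<Rightarrow> complex ^ 'n \<Rightarrow> complex ^ 'n ^ 'n" where
  "stab_prec M D x =
     (mat 1 - mat (1 / cip x (D *v (matrix_inv M *v (D *v x))))
                ** (outer (matrix_inv M *v (D *v x)) x ** D)) ** matrix_inv M"

definition correction_residual ::
    "complex ^ 'n ^ 'n \<Rightarrow> complex ^ 'n ^ 'n \<Rightarrow> complex ^ 'n \<Rightarrow> complex ^ 'n \<Rightarrow> complex ^ 'n" where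
  "correction_residual A D x \<Delta> = (jd_proj D x ** A ** cadjoint (jd_proj D x)) *v \<Delta> + A *v x"

definition gmres_space ::
    "complex ^ 'n ^ 'n \<Rightarrow> complex ^ 'n ^ 'n \<Rightarrow> complex ^ 'n ^ 'n \<Rightarrow> complex ^ 'n \<Rightarrow> nat \<Rightarrow> (complex ^ 'n) set" where
  "gmres_space M A D x m =
     (*v) (stab_prec M D x) `
       krylov m (jd_proj D x ** A ** cadjoint (jd_proj D x) ** stab_prec M D x) (A *v x)"

definition gmres_cycle ::
    "complex ^ 'n ^ 'n \<Rightarrow> complex ^ 'n ^ 'n \<Rightarrow> complex ^ 'n ^ 'n \<Rightarrow> complex ^ 'n \<Rightarrow> nat \<Rightarrow> complex ^ 'n \<Rightarrow> bool" where
  "gmres_cycle M A D x m \<Delta> \<longleftrightarrow>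
     \<Delta> \<in> gmres_space M A D x m \<and>
     (\<forall>\<Delta>'\<in>gmres_space M A D x m.
        norm (correction_residual A D x \<Delta>) \<le> norm (correction_residual A D x \<Delta>'))"

definition gmres_delivers ::
    "complex ^ 'n ^ 'n \<Rightarrow> complex ^ 'n ^ 'n \<Rightarrow> complex ^ 'n ^ 'n \<Rightarrow> complex ^ 'n \<Rightarrow> nat \<Rightarrow> real \<Rightarrow> bool" where
  "gmres_delivers M A D x m \<tau> \<longleftrightarrow>
     (\<exists>\<Delta>. gmres_cycle M A D x m \<Delta> \<and> norm (correction_residual A D x \<Delta>) \<le> \<tau> * norm (A *v x))"


section \<open>Refined projection\<close>

text \<open>A matrix \<open>U\<close> with columns \<open>u\<^sub>0, \<dots>, u\<^bsub>d-1\<^esub>\<close>, where \<open>d\<close> varies from iteration to iteration,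
  is the list \<open>us\<close> of its columns, and a coefficient vector \<open>y\<close> of length \<open>d\<close> is a function of
  which only the values at \<open>0, \<dots>, d-1\<close> matter.  \<open>mult_cols us y\<close> is \<open>U y\<close>, and the entries of
  \<open>U\<^sup>* w\<close> are \<open>cip (us ! i) w\<close>.\<close>

definition orthonormal_cols :: "(complex ^ 'n) list \<Rightarrow> bool" where
  "orthonormal_cols us \<longleftrightarrow>
     (\<forall>i<length us. \<forall>j<length us. cip (us ! i) (us ! j) = (if i = j then 1 else 0))"

definition mult_cols :: "(complex ^ 'n) list \<Rightarrow> (nat \<Rightarrow> complex) \<Rightarrow> complex ^ 'n" where
  "mult_cols us y = (\<Sum>j<length us. y j *s us ! j)"

definition coeff_norm :: "(complex ^ 'n) list \<Rightarrow> (nat \<Rightarrow> complex) \<Rightarrow> real" where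
  "coeff_norm us y = sqrt (\<Sum>j<length us. (cmod (y j))\<^sup>2)"

text \<open>The vectors \<open>U y\<close> with \<open>U\<^sup>* T(\<nu>) U y = 0\<close>.\<close>

definition ritz_space :: "(real \<Rightarrow> complex ^ 'n ^ 'n) \<Rightarrow> (complex ^ 'n) list \<Rightarrow> real \<Rightarrow> (complex ^ 'n) set" where
  "ritz_space T us \<nu> =
     {mult_cols us y | y. \<forall>i<length us. cip (us ! i) (T \<nu> *v mult_cols us y) = 0}"

text \<open>A full set of Ritz pairs in the interval; multiple Ritz values occur with their multiplicity,
  i.e. with a basis of the corresponding space of Ritz vectors.\<close>

definition ritz_pairs ::
    "real \<Rightarrow> real \<Rightarrow> (real \<Rightarrow> complex ^ 'n ^ 'n) \<Rightarrow> (complex ^ 'n) list \<Rightarrow> (real \<times> (complex ^ 'n)) set \<Rightarrow> bool" where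
  "ritz_pairs a b T us P \<longleftrightarrow>
     finite P \<and> fst ` P \<subseteq> {a<..<b} \<and>
     (\<forall>\<nu>\<in>{a<..<b}. vec.independent {z. (\<nu>, z) \<in> P} \<and>
                    vec.span {z. (\<nu>, z) \<in> P} = ritz_space T us \<nu>)"

text \<open>\<open>R\<close> consists of the (up to) \<open>r\<close> elements of \<open>P\<close> with the smallest values of \<open>f\<close>, ties being
  broken arbitrarily.\<close>

definition smallest_by :: "nat \<Rightarrow> ('a \<Rightarrow> real) \<Rightarrow> 'a set \<Rightarrow> 'a set \<Rightarrow> bool" where
  "smallest_by r f P R \<longleftrightarrow>
     R \<subseteq> P \<and> card R = min r (card P) \<and> (\<forall>p\<in>R. \<forall>q\<in>P - R. f p \<le> f q)"

text \<open>The norm of the type \<^typ>\<open>complex ^ 'n ^ 'n\<close> is the Frobenius norm.\<close>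

definition rel_residual :: "(real \<Rightarrow> complex ^ 'n ^ 'n) \<Rightarrow> real \<times> (complex ^ 'n) \<Rightarrow> real" where
  "rel_residual T p = norm (T (fst p) *v snd p) / (norm (T (fst p)) * norm (snd p))"

definition refined_vector ::
    "real \<Rightarrow> real \<Rightarrow> (real \<Rightarrow> complex ^ 'n ^ 'n) \<Rightarrow> real \<Rightarrow> nat \<Rightarrow> nat \<Rightarrow>
      (complex ^ 'n) set \<Rightarrow> complex ^ 'n \<Rightarrow> bool" where
  "refined_vector a b T \<sigma> r s \<U> w \<longleftrightarrow>
     (\<exists>us P R S p y.
        orthonormal_cols us \<and> vec.span (set us) = \<U> \<and>
        ritz_pairs a b T us P \<and>
        smallest_by r (\<lambda>p. \<bar>fst p - \<sigma>\<bar>) P R \<and>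
        smallest_by s (rel_residual T) R S \<and>
        p \<in> S \<and> (\<forall>q\<in>S. \<bar>fst p - \<sigma>\<bar> \<le> \<bar>fst q - \<sigma>\<bar>) \<and>
        coeff_norm us y = 1 \<and>
        (\<forall>y'. coeff_norm us y' = 1 \<longrightarrow>
           norm (T (fst p) *v mult_cols us y) \<le> norm (T (fst p) *v mult_cols us y')) \<and>
        w = mult_cols us y)"


section \<open>The PLMR iteration\<close>

definition plmr_direction :: "(nat \<Rightarrow> complex ^ 'n) \<Rightarrow> nat \<Rightarrow> complex ^ 'n" where
  "plmr_direction x k = (case k of 0 \<Rightarrow> 0 | Suc j \<Rightarrow> x (Suc j) - x j)"

definition plmr_space ::
    "(real \<Rightarrow> complex ^ 'n ^ 'n) \<Rightarrow> (real \<Rightarrow> complex ^ 'n ^ 'n) \<Rightarrow> (complex ^ 'n \<Rightarrow> real) \<Rightarrow>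
      complex ^ 'n ^ 'n \<Rightarrow> (nat \<Rightarrow> nat) \<Rightarrow> (nat \<Rightarrow> complex ^ 'n) \<Rightarrow> nat \<Rightarrow> (complex ^ 'n) set" where
  "plmr_space T T' \<rho> M m x k =
     {u + w | u w.
        u \<in> krylov (m k + 1) (stab_prec M (T' (\<rho> (x k))) (x k) ** T (\<rho> (x k))) (x k) \<and>
        w \<in> vec.span {plmr_direction x k}}"

definition plmr_sequence ::
    "real \<Rightarrow> real \<Rightarrow> (real \<Rightarrow> complex ^ 'n ^ 'n) \<Rightarrow> (real \<Rightarrow> complex ^ 'n ^ 'n) \<Rightarrow> (complex ^ 'n \<Rightarrow> real) \<Rightarrow>
      complex ^ 'n ^ 'n \<Rightarrow> real \<Rightarrow> nat \<Rightarrow> nat \<Rightarrow> (nat \<Rightarrow> nat) \<Rightarrow> (nat \<Rightarrow> complex ^ 'n) \<Rightarrow> bool" where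
  "plmr_sequence a b T T' \<rho> M \<sigma> r s m x \<longleftrightarrow>
     x 0 \<noteq> 0 \<and>
     (\<forall>k. let D = T' (\<rho> (x k)) in
        cip (x k) (D *v x k) \<noteq> 0 \<and>
        cip (x k) (D *v (matrix_inv M *v (D *v x k))) \<noteq> 0) \<and>
     (\<forall>k. \<exists>w \<beta>. refined_vector a b T \<sigma> r s (plmr_space T T' \<rho> M m x k) w \<and>
        \<beta> > 0 \<and> x (Suc k) = \<beta> *\<^sub>R w \<and>
        cip (x (Suc k)) (T' (\<rho> (x (Suc k))) *v x (Suc k)) = 1)"


section \<open>Convergence orders\<close>

definition at_least_linearly :: "(nat \<Rightarrow> real) \<Rightarrow> bool" where
  "at_least_linearly \<epsilon> \<longleftrightarrow> \<epsilon> \<longlonglongrightarrow> 0 \<and> (\<exists>q. 0 \<le> q \<and> q < 1 \<and> (\<forall>k. \<epsilon> (Suc k) \<le> q * \<epsilon> k))"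

definition at_least_quadratically :: "(nat \<Rightarrow> real) \<Rightarrow> bool" where
  "at_least_quadratically \<epsilon> \<longleftrightarrow> \<epsilon> \<longlonglongrightarrow> 0 \<and> (\<exists>K. \<forall>k. \<epsilon> (Suc k) \<le> K * (\<epsilon> k)\<^sup>2)"

definition at_least_cubically :: "(nat \<Rightarrow> real) \<Rightarrow> bool" where
  "at_least_cubically \<epsilon> \<longleftrightarrow> \<epsilon> \<longlonglongrightarrow> 0 \<and> (\<exists>K. \<forall>k. \<epsilon> (Suc k) \<le> K * (\<epsilon> k) ^ 3)"

end

theory Submission
  imports Defs
begin

text \<open>By the stabilization of the preconditioner, the GMRES update \<open>x\<^sub>k + \<Delta>x\<^sub>k\<close> lies in the PLMR search
  space, and it solves \<open>T(\<rho>\<^sub>k) y = q + \<alpha> T'(\<rho>\<^sub>k) x\<^sub>k\<close>, \<open>x\<^sub>k\<^sup>* T'(\<rho>\<^sub>k) y = x\<^sub>k\<^sup>* T'(\<rho>\<^sub>k) x\<^sub>k\<close> with a GMRES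
  residual \<open>q\<close>.  At \<open>(\<lambda>, v)\<close> this bordered system is nonsingular because the eigenvalue is simple, so
  near \<open>(\<lambda>, v)\<close> its inverse is uniformly bounded.  A multiple of \<open>v\<close> solves it up to \<open>T(\<rho>\<^sub>k) v\<close> modulo
  the border, which is \<open>O(\<rho>\<^sub>k - \<lambda>) = O(\<epsilon>\<^sub>k\<^sup>2)\<close>, and \<open>O(\<epsilon>\<^sub>k\<^sup>3)\<close> under the Hoelder condition.  Hence the angle
  between \<open>v\<close> and the search space is \<open>O(\<tau>\<^sub>k \<epsilon>\<^sub>k + \<epsilon>\<^sub>k\<^sup>2)\<close>, respectively \<open>O(\<tau>\<^sub>k \<epsilon>\<^sub>k + \<epsilon>\<^sub>k\<^sup>3)\<close>.\<close>

section \<open>The sesquilinear form and matrix action\<close>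

lemma scaleR_eq_smult: "r *\<^sub>R x = complex_of_real r *s (x :: complex ^ 'n)"
  by (simp add: vec_eq_iff scaleR_conv_of_real[where 'a = complex])

lemma norm_smult: "norm (c *s x) = cmod c * norm (x :: complex ^ 'n)"
  by (simp add: norm_vec_def norm_mult L2_set_right_distrib)

lemma cip_add_right: "cip x (y + z) = cip x y + cip x z"
  by (simp add: cip_def distrib_left sum.distrib)

lemma cip_add_left: "cip (x + y) z = cip x z + cip y z"
  by (simp add: cip_def distrib_right sum.distrib)

lemma cip_diff_right: "cip x (y - z) = cip x y - cip x z"
  by (simp add: cip_def right_diff_distrib sum_subtractf)

lemma cip_diff_left: "cip (x - y) z = cip x z - cip y z"
  by (simp add: cip_def left_diff_distrib sum_subtractf)

lemma cip_smult_right: "cip x (c *s y) = c * cip x y"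
  by (simp add: cip_def sum_distrib_left mult.left_commute)

lemma cip_smult_left: "cip (c *s x) y = cnj c * cip x y"
  by (simp add: cip_def sum_distrib_left mult.assoc)

lemma cip_zero_right [simp]: "cip x 0 = 0"
  by (simp add: cip_def)

lemma cip_zero_left [simp]: "cip 0 x = 0"
  by (simp add: cip_def)

lemma cnj_cip: "cnj (cip x y) = cip y x"
  by (simp add: cip_def mult.commute)

lemma cip_self: "cip x x = complex_of_real ((norm x)\<^sup>2)"
  by (simp add: cip_def norm_vec_def L2_set_def sum_nonneg complex_norm_square[unfolded of_real_power]
      mult.commute)

lemma cmod_cip_le: "cmod (cip x y) \<le> norm x * norm y"
proof -
  have "cmod (cip x y) \<le> (\<Sum>i\<in>UNIV. \<bar>cmod (x $ i)\<bar> * \<bar>cmod (y $ i)\<bar>)"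
    unfolding cip_def by (rule sum_norm_le) (simp add: norm_mult)
  also have "\<dots> \<le> norm x * norm y"
    unfolding norm_vec_def by (rule L2_set_mult_ineq)
  finally show ?thesis .
qed

text \<open>Cauchy-Schwarz in each row, then the l2 norm over the rows; the matrix norm is the
  Frobenius norm.\<close>

lemma norm_matrix_vector_le: "norm (A *v x) \<le> norm A * norm (x :: complex ^ 'n)"
proof -
  have "norm ((A *v x) $ i) \<le> norm (A $ i) * norm x" for i
  proof -
    have "norm ((A *v x) $ i) \<le> (\<Sum>j\<in>UNIV. \<bar>cmod (A $ i $ j)\<bar> * \<bar>cmod (x $ j)\<bar>)"
      unfolding matrix_vector_mult_def by (simp add: sum_norm_le norm_mult)
    also have "\<dots> \<le> norm (A $ i) * norm x"
      unfolding norm_vec_def by (rule L2_set_mult_ineq)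
    finally show ?thesis .
  qed
  then have "norm (A *v x) \<le> L2_set (\<lambda>i. norm (A $ i) * norm x) UNIV"
    unfolding norm_vec_def[of "A *v x"] by (intro L2_set_mono) auto
  also have "\<dots> = norm A * norm x"
    by (simp add: norm_vec_def[of A] L2_set_left_distrib)
  finally show ?thesis .
qed

lemma matrix_vector_mult_smult: "A *v (c *s x) = c *s (A *v (x :: complex ^ 'n))"
  by (simp add: matrix_vector_mult_def vec_eq_iff sum_distrib_left mult.left_commute)

lemma matrix_scaleR_vector: "(r *\<^sub>R A) *v x = complex_of_real r *s (A *v (x :: complex ^ 'n))"
  by (simp add: matrix_vector_mult_def vec_eq_iff sum_distrib_left)
    (simp add: scaleR_conv_of_real[where 'a = complex] mult.assoc)

lemma mat_vector_mult: "mat c *v x = c *s (x :: complex ^ 'n)"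
  by (simp add: vec_eq_iff matrix_vector_mult_def mat_def if_distrib[of "\<lambda>z. z * _"] cong: if_cong)

lemma outer_vector_mult: "outer x y *v z = cip y z *s x"
  by (simp add: vec_eq_iff matrix_vector_mult_def outer_def cip_def sum_distrib_left mult_ac)

lemma cip_cadjoint: "cip x (A *v y) = cip (cadjoint A *v x) y"
proof -
  have "cip x (A *v y) = (\<Sum>i\<in>UNIV. \<Sum>j\<in>UNIV. cnj (x $ i) * A $ i $ j * y $ j)"
    by (simp add: cip_def matrix_vector_mult_def sum_distrib_left mult.assoc)
  also have "\<dots> = (\<Sum>j\<in>UNIV. \<Sum>i\<in>UNIV. cnj (x $ i) * A $ i $ j * y $ j)"
    by (rule sum.swap)
  also have "\<dots> = cip (cadjoint A *v x) y"
    by (simp add: cip_def matrix_vector_mult_def cadjoint_def sum_distrib_left mult_ac)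
  finally show ?thesis .
qed

lemma hermitian_cip: "hermitian A \<Longrightarrow> cip x (A *v y) = cip (A *v x) y"
  by (metis cip_cadjoint hermitian_def)

lemma cip_eqI: "(\<And>u. cip u y = cip u z) \<Longrightarrow> y = z"
proof -
  assume "\<And>u. cip u y = cip u z"
  then have "cip (y - z) (y - z) = 0"
    by (simp add: cip_diff_right)
  then show "y = z"
    by (simp add: cip_self)
qed

lemma tendsto_cip [tendsto_intros]:
  "(f \<longlongrightarrow> x) F \<Longrightarrow> (g \<longlongrightarrow> y) F \<Longrightarrow> ((\<lambda>z. cip (f z) (g z)) \<longlongrightarrow> cip x y) F"
  unfolding cip_def by (intro tendsto_intros)

lemma tendsto_matrix_vector_mult:
  fixes A :: "complex ^ 'n ^ 'm"
  shows "(f \<longlongrightarrow> A) F \<Longrightarrow> (g \<longlongrightarrow> y) F \<Longrightarrow> ((\<lambda>z. f z *v g z) \<longlongrightarrow> A *v y) F"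
  unfolding matrix_vector_mult_def by (intro tendsto_intros)


section \<open>Angles\<close>

lemma vec_angle_commute: "vec_angle x y = vec_angle y x"
proof -
  have "cmod (cip x y) = cmod (cip y x)"
    by (metis cnj_cip complex_mod_cnj)
  then show ?thesis
    by (simp add: vec_angle_def mult.commute)
qed

text \<open>If one vector vanishes, the quotient is 0 by the convention for division by zero;
  otherwise this is Cauchy-Schwarz.\<close>

lemma cos_vec_angle_le_1: "cmod (cip x y) / (norm x * norm y) \<le> 1"
  using cmod_cip_le[of x y] by (cases "x = 0 \<or> y = 0") auto

lemma vec_angle_nonneg: "0 \<le> vec_angle x y"
  unfolding vec_angle_def
  by (rule arccos_lbound) (use cos_vec_angle_le_1[of x y] in \<open>auto intro: order_trans[of _ 0]\<close>)

lemma vec_angle_le: "vec_angle x y \<le> pi / 2"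
  unfolding vec_angle_def
  by (rule arccos_le_pi2) (use cos_vec_angle_le_1[of x y] in auto)

lemma sin_vec_angle_nonneg: "0 \<le> sin (vec_angle x y)"
  using vec_angle_nonneg[of x y] vec_angle_le[of x y] by (intro sin_ge_zero) auto

text \<open>The Pythagorean identity cleared of denominators; both estimates of angles by distances
  below are read off from it.\<close>

lemma sin_vec_angle_squared:
  assumes "x \<noteq> 0" "y \<noteq> 0"
  shows "(sin (vec_angle x y))\<^sup>2 * ((norm x)\<^sup>2 * (norm y)\<^sup>2) = (norm x)\<^sup>2 * (norm y)\<^sup>2 - (cmod (cip x y))\<^sup>2"
proof -
  define q where "q = cmod (cip x y) / (norm x * norm y)"
  have q: "0 \<le> q" "q \<le> 1"
    using cos_vec_angle_le_1[of x y] by (auto simp: q_def)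
  have "cos (vec_angle x y) = q"
    unfolding vec_angle_def q_def[symmetric] using q by (intro cos_arccos) auto
  then have "(sin (vec_angle x y))\<^sup>2 = 1 - q\<^sup>2"
    by (simp add: sin_squared_eq)
  then show ?thesis
    using assms by (simp add: q_def field_simps)
qed

text \<open>The left side is the distance from \<open>y\<close> to the complex line through
  \<open>x\<close>, and no multiple of \<open>x\<close> comes closer.\<close>

lemma sin_vec_angle_le_dist:
  assumes "x \<noteq> 0" "y \<noteq> 0"
  shows "sin (vec_angle x y) * norm y \<le> norm (y - \<beta> *s x)"
proof -
  let ?p = "cmod (cip x y)" and ?X = "norm x"
  have X: "?X > 0" using assms by simp
  have "complex_of_real ((norm (y - \<beta> *s x))\<^sup>2) = cip (y - \<beta> *s x) (y - \<beta> *s x)"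
    by (simp add: cip_self)
  also have "\<dots> = cip y y + cnj \<beta> * \<beta> * cip x x - (\<beta> * cip y x + cnj (\<beta> * cip y x))"
    by (simp add: cip_diff_left cip_diff_right cip_smult_left cip_smult_right cnj_cip algebra_simps)
  also have "\<dots> = complex_of_real ((norm y)\<^sup>2 + (cmod \<beta>)\<^sup>2 * ?X\<^sup>2 - 2 * Re (\<beta> * cip y x))"
    unfolding complex_add_cnj by (simp add: cip_self complex_norm_square[unfolded of_real_power] mult_ac)
  finally have eq: "(norm (y - \<beta> *s x))\<^sup>2 = (norm y)\<^sup>2 + (cmod \<beta>)\<^sup>2 * ?X\<^sup>2 - 2 * Re (\<beta> * cip y x)"
    by (metis of_real_eq_iff)
  have "Re (\<beta> * cip y x) \<le> cmod (\<beta> * cip y x)"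
    by (rule complex_Re_le_cmod)
  also have "\<dots> = cmod \<beta> * ?p"
    by (metis cnj_cip complex_mod_cnj norm_mult)
  finally have re: "Re (\<beta> * cip y x) \<le> cmod \<beta> * ?p" .
  \<comment> \<open>Completing the square in \<open>cmod \<beta>\<close> compares the distance with
    its minimum over the line.\<close>
  have "0 \<le> (cmod \<beta> * ?X - ?p / ?X)\<^sup>2" by simp
  also have "\<dots> = (cmod \<beta>)\<^sup>2 * ?X\<^sup>2 - 2 * (cmod \<beta> * ?p) + ?p\<^sup>2 / ?X\<^sup>2"
    using X by (simp add: power2_diff power_mult_distrib power_divide)
  finally have "(norm y)\<^sup>2 - ?p\<^sup>2 / ?X\<^sup>2 \<le> (norm (y - \<beta> *s x))\<^sup>2"
    using eq re by linarith
  moreover have "(sin (vec_angle x y) * norm y)\<^sup>2 = (norm y)\<^sup>2 - ?p\<^sup>2 / ?X\<^sup>2"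
    using sin_vec_angle_squared[OF assms] X by (simp add: field_simps)
  ultimately have "(sin (vec_angle x y) * norm y)\<^sup>2 \<le> (norm (y - \<beta> *s x))\<^sup>2"
    by simp
  then show ?thesis
    by (rule power2_le_imp_le) simp
qed

text \<open>Orthogonal projection onto \<open>v\<close>: \<open>\<beta> *s v\<close> is the
  component along \<open>v\<close>, and \<open>w\<close> is the orthogonal remainder divided by
  \<open>\<beta>\<close>. With the scale factored out, a small angle becomes a small perturbation
  \<open>w\<close> of \<open>v\<close>.\<close>

lemma vec_angle_small_decomp:
  assumes "v \<noteq> 0" "x \<noteq> 0" "sin (vec_angle v x) \<le> 1 / 2"
  obtains \<beta> w where "\<beta> \<noteq> 0" "x = \<beta> *s (v + w)" "norm w \<le> 2 * norm v * sin (vec_angle v x)"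
proof -
  let ?e = "sin (vec_angle v x)"
  define \<beta> where "\<beta> = cip v x / cip v v"
  define u where "u = x - \<beta> *s v"
  have V: "norm v > 0" using assms by simp
  have vv: "cip v v \<noteq> 0" using assms by (simp add: cip_self)
  have e0: "0 \<le> ?e" by (rule sin_vec_angle_nonneg)
  have orth: "cip v u = 0" "cip u v = 0"
    using vv by (simp_all add: u_def \<beta>_def cip_diff_left cip_diff_right cip_smult_left cip_smult_right cnj_cip)
  have "complex_of_real ((norm x)\<^sup>2) = cip (u + \<beta> *s v) (u + \<beta> *s v)"
    by (simp add: u_def cip_self)
  also have "\<dots> = cip u u + \<beta> * cnj \<beta> * cip v v"
    using orth by (simp add: cip_add_left cip_add_right cip_smult_left cip_smult_right)
  also have "\<dots> = complex_of_real ((norm u)\<^sup>2 + (cmod \<beta>)\<^sup>2 * (norm v)\<^sup>2)"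
    by (simp add: cip_self complex_norm_square[unfolded of_real_power])
  finally have x2: "(norm x)\<^sup>2 = (norm u)\<^sup>2 + (cmod \<beta>)\<^sup>2 * (norm v)\<^sup>2"
    by (metis of_real_eq_iff)
  have "cmod (cip v x) = cmod \<beta> * (norm v)\<^sup>2"
    using V by (simp add: \<beta>_def norm_divide cip_self norm_power)
  then have "?e\<^sup>2 * ((norm v)\<^sup>2 * (norm x)\<^sup>2) = (norm v)\<^sup>2 * (norm x)\<^sup>2 - (cmod \<beta> * (norm v)\<^sup>2)\<^sup>2"
    using sin_vec_angle_squared[OF assms(1,2)] by simp
  also have "\<dots> = (norm v)\<^sup>2 * (norm u)\<^sup>2"
    unfolding x2 by (simp add: power2_eq_square algebra_simps)
  finally have "?e\<^sup>2 * ((norm v)\<^sup>2 * (norm x)\<^sup>2) = (norm v)\<^sup>2 * (norm u)\<^sup>2" .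
  then have u2: "(norm u)\<^sup>2 = ?e\<^sup>2 * (norm x)\<^sup>2"
    using V by (simp add: mult.left_commute)
  have "?e\<^sup>2 \<le> (1 / 2)\<^sup>2"
    using e0 assms(3) by (intro power_mono) auto
  then have "(norm u)\<^sup>2 \<le> (1 / 4) * (norm x)\<^sup>2"
    unfolding u2 by (intro mult_right_mono) (auto simp: power2_eq_square)
  \<comment> \<open>The remainder takes at most a quarter of the squared norm, so the factor 4/3
    would do; 4 has the convenient root 2.\<close>
  then have x2': "(norm x)\<^sup>2 \<le> 4 * ((cmod \<beta>)\<^sup>2 * (norm v)\<^sup>2)"
    using x2 zero_le_power2[of "norm u"] by linarith
  then have b: "\<beta> \<noteq> 0"
    using assms(2) by auto
  have "(norm u)\<^sup>2 \<le> ?e\<^sup>2 * (4 * ((cmod \<beta>)\<^sup>2 * (norm v)\<^sup>2))"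
    unfolding u2 by (intro mult_left_mono x2') auto
  also have "\<dots> = (cmod \<beta> * (2 * norm v * ?e))\<^sup>2"
    by (simp add: power_mult_distrib)
  finally have "norm u \<le> cmod \<beta> * (2 * norm v * ?e)"
    by (rule power2_le_imp_le) (use e0 in auto)
  moreover have "norm ((1 / \<beta>) *s u) = norm u / cmod \<beta>"
    by (simp add: norm_smult norm_divide)
  ultimately have "norm ((1 / \<beta>) *s u) \<le> 2 * norm v * ?e"
    using b by (simp only:) (simp add: pos_divide_le_eq mult_ac)
  moreover have "x = \<beta> *s (v + (1 / \<beta>) *s u)"
    using b by (simp add: u_def vector_add_ldistrib vector_smult_assoc)
  ultimately show ?thesis
    using that b by blast
qed

text \<open>An infimum of angles lies below each of them, and the sine is monotone on the interval
  from 0 to \<open>pi / 2\<close>, which contains all of these angles.\<close>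

lemma sin_subspace_angle_le:
  assumes "y \<in> U" "y \<noteq> 0"
  shows "sin (subspace_angle v U) \<le> sin (vec_angle v y)"
proof -
  have "bdd_below (vec_angle v ` (U - {0}))"
    by (rule bdd_belowI[of _ 0]) (auto simp: vec_angle_nonneg)
  then have "subspace_angle v U \<le> vec_angle v y"
    unfolding subspace_angle_def using assms by (intro cINF_lower) auto
  moreover have "0 \<le> subspace_angle v U"
    unfolding subspace_angle_def using assms by (intro cINF_greatest) (auto simp: vec_angle_nonneg)
  ultimately show ?thesis
    using vec_angle_le[of v y] by (intro sin_monotone_2pi_le) auto
qed


section \<open>GMRES iterates in the PLMR search space\<close>

lemma jd_proj_vector:
  "jd_proj D x *v z = z - (cip x z / cip x (D *v x)) *s (D *v x)"
  by (simp add: jd_proj_def matrix_vector_mult_diff_rdistrib matrix_vector_mul_assoc[symmetric]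
      mat_vector_mult outer_vector_mult vector_smult_assoc)

lemma stab_prec_vector:
  fixes M D :: "complex ^ 'n ^ 'n"
  defines "N \<equiv> matrix_inv M"
  shows "stab_prec M D x *v z =
     N *v z - (cip x (D *v (N *v z)) / cip x (D *v (N *v (D *v x)))) *s (N *v (D *v x))"
  by (simp add: stab_prec_def N_def matrix_vector_mult_diff_rdistrib matrix_vector_mul_assoc[symmetric]
      mat_vector_mult outer_vector_mult vector_smult_assoc)

text \<open>Testing against an arbitrary \<open>u\<close> moves the adjoint to the other side;
  \<open>D\<close> being Hermitian, \<open>cip x (D *v x)\<close> is real and survives the
  conjugation.\<close>

lemma cadjoint_jd_proj_vector:
  assumes "hermitian D"
  shows "cadjoint (jd_proj D x) *v z = z - (cip x (D *v z) / cip x (D *v x)) *s x"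
proof (rule cip_eqI)
  fix u
  have "cip u (cadjoint (jd_proj D x) *v z) = cnj (cip z (jd_proj D x *v u))"
    by (simp add: cip_cadjoint cnj_cip)
  also have "\<dots> = cip u z - cip x (D *v z) / cip x (D *v x) * cip u x"
    using assms by (simp add: jd_proj_vector cip_diff_right cip_smult_right cnj_cip hermitian_cip)
  finally show "cip u (cadjoint (jd_proj D x) *v z)
      = cip u (z - (cip x (D *v z) / cip x (D *v x)) *s x)"
    by (simp add: cip_diff_right cip_smult_right)
qed

text \<open>The coefficient of the rank-one term is the one that cancels the pairing with
  \<open>D *v x\<close>. On the range of the stabilized preconditioner the adjoint projector is
  therefore the identity.\<close>

lemma stab_prec_orthogonal:
  assumes "cip x (D *v (matrix_inv M *v (D *v x))) \<noteq> 0"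
  shows "cip x (D *v (stab_prec M D x *v z)) = 0"
  using assms
  by (simp add: stab_prec_vector matrix_vector_mult_diff_distrib matrix_vector_mult_smult
      cip_diff_right cip_smult_right)

text \<open>The stabilized preconditioner annihilates \<open>D *v x\<close>, the only direction that
  the projector changes, and so absorbs the projector from the left.\<close>

lemma stab_prec_jd_proj:
  assumes "cip x (D *v (matrix_inv M *v (D *v x))) \<noteq> 0"
  shows "stab_prec M D x *v (jd_proj D x *v z) = stab_prec M D x *v z"
proof -
  have "stab_prec M D x *v (D *v x) = 0"
    using assms by (simp add: stab_prec_vector)
  then show ?thesis
    by (simp add: jd_proj_vector matrix_vector_mult_diff_distrib matrix_vector_mult_smult)
qed

lemma cadjoint_jd_proj_eq:
  assumes "hermitian D" "cip x (D *v z) = 0"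
  shows "cadjoint (jd_proj D x) *v z = z"
  using assms by (simp add: cadjoint_jd_proj_vector)

text \<open>Both projectors are absorbed, so \<open>?S ** ?G\<close> acts as
  \<open>?S ** A ** ?S\<close>: the preconditioner intertwines the GMRES operator with the PLMR
  operator and maps one Krylov sequence into the other.\<close>

lemma gmres_space_subset_krylov:
  assumes "hermitian D" and ne: "cip x (D *v (matrix_inv M *v (D *v x))) \<noteq> 0"
  shows "gmres_space M A D x m \<subseteq> krylov (m + 1) (stab_prec M D x ** A) x"
proof -
  let ?S = "stab_prec M D x"
  let ?G = "jd_proj D x ** A ** cadjoint (jd_proj D x) ** ?S"
  let ?K = "krylov (m + 1) (?S ** A) x"
  have step: "?S *v (?G *v q) = (?S ** A) *v (?S *v q)" for q
    using cadjoint_jd_proj_eq[OF assms(1) stab_prec_orthogonal[OF ne]]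
    by (simp add: matrix_vector_mul_assoc[symmetric] stab_prec_jd_proj[OF ne])
  \<comment> \<open>The index shifts by one because GMRES starts from \<open>A *v x\<close> and PLMR
    from \<open>x\<close>; this is why the dimension is \<open>m + 1\<close>.\<close>
  have pow: "?S *v ((((*v) ?G) ^^ i) (A *v x)) = (((*v) (?S ** A)) ^^ Suc i) x" for i
    by (induction i) (simp_all add: step, simp add: matrix_vector_mul_assoc)
  \<comment> \<open>The preimage of \<open>?K\<close> is a subspace, so it suffices to check the
    Krylov generators.\<close>
  have "vec.subspace {z. ?S *v z \<in> ?K}"
    unfolding krylov_def vec.subspace_def
    by (auto simp: matrix_vector_mult_smult matrix_vector_right_distrib vec.span_zero
        intro: vec.span_add vec.span_scale)
  moreover have "(\<lambda>i. (((*v) ?G) ^^ i) (A *v x)) ` {..<m} \<subseteq> {z. ?S *v z \<in> ?K}"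
    unfolding krylov_def by (auto simp: pow simp del: funpow.simps intro!: vec.span_base)
  ultimately have "krylov m ?G (A *v x) \<subseteq> {z. ?S *v z \<in> ?K}"
    unfolding krylov_def[of m] by (rule vec.span_minimal[rotated])
  then show ?thesis
    unfolding gmres_space_def by auto
qed

text \<open>The solution of the projected equation solves the equation of one step of inverse iteration
  with residual \<open>q\<close>; since \<open>x\<^sup>* A x = 0\<close>, the projector leaves the right-hand side unchanged.\<close>

lemma gmres_delivers_update:
  assumes D: "hermitian D" and ne: "cip x (D *v (matrix_inv M *v (D *v x))) \<noteq> 0"
    and Ax: "cip x (A *v x) = 0"
    and "gmres_delivers M A D x m \<tau>"
  obtains y q \<alpha> where "y \<in> krylov (m + 1) (stab_prec M D x ** A) x"
    "A *v y = q + \<alpha> *s (D *v x)" "cip x (D *v y) = cip x (D *v x)" "norm q \<le> \<tau> * norm (A *v x)"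
proof -
  let ?K = "krylov (m + 1) (stab_prec M D x ** A) x"
  obtain d where d: "d \<in> gmres_space M A D x m"
    and res: "norm (correction_residual A D x d) \<le> \<tau> * norm (A *v x)"
    using assms(4) by (auto simp: gmres_delivers_def gmres_cycle_def)
  have xd: "cip x (D *v d) = 0"
    using d stab_prec_orthogonal[OF ne] by (auto simp: gmres_space_def)
  \<comment> \<open>\<open>\<alpha>\<close> is the coefficient of the component along
    \<open>D *v x\<close> that the left projector removes; it becomes the extra unknown of the
    bordered system.\<close>
  define \<alpha> where "\<alpha> = cip x (A *v d) / cip x (D *v x)"
  have eq: "correction_residual A D x d = A *v d - \<alpha> *s (D *v x) + A *v x"
    using cadjoint_jd_proj_eq[OF D xd]
    by (simp add: correction_residual_def matrix_vector_mul_assoc[symmetric] jd_proj_vector \<alpha>_def)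
  have "x \<in> ?K"
    unfolding krylov_def by (intro vec.span_base image_eqI[of _ _ 0]) auto
  moreover have "d \<in> ?K"
    using gmres_space_subset_krylov[OF D ne] d by blast
  ultimately have "x + d \<in> ?K"
    unfolding krylov_def by (rule vec.span_add)
  moreover have "A *v (x + d) = correction_residual A D x d + \<alpha> *s (D *v x)"
    by (simp add: eq matrix_vector_right_distrib)
  moreover have "cip x (D *v (x + d)) = cip x (D *v x)"
    by (simp add: matrix_vector_right_distrib cip_add_right xd)
  ultimately show ?thesis
    using that res by blast
qed

section \<open>Local analysis at a simple eigenpair\<close>

text \<open>Conjugation makes the adjoint only real linear, which suffices because \<open>T\<close>
  is differentiated in a real parameter.\<close>

lemma bounded_linear_cadjoint: "bounded_linear (cadjoint :: complex ^ 'n ^ 'n \<Rightarrow> _)"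
  by (intro linear_conv_bounded_linear[THEN iffD1] linearI)
    (simp_all add: cadjoint_def vec_eq_iff)

text \<open>On the open interval \<open>T\<close> agrees with its adjoint, so
  \<open>T' \<mu>\<close> and its adjoint are derivatives of the same function.\<close>

lemma hermitian_nep_derivative:
  assumes "hermitian_nep a b T T'" "\<mu> \<in> {a<..<b}"
  shows "hermitian (T' \<mu>)"
proof -
  have T: "(T has_vector_derivative T' \<mu>) (at \<mu>)" and herm: "\<And>\<nu>. \<nu> \<in> {a<..<b} \<Longrightarrow> cadjoint (T \<nu>) = T \<nu>"
    using assms by (auto simp: hermitian_nep_def hermitian_def)
  have "((\<lambda>\<nu>. cadjoint (T \<nu>)) has_vector_derivative cadjoint (T' \<mu>)) (at \<mu>)"
    by (rule bounded_linear.has_vector_derivative[OF bounded_linear_cadjoint T])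
  then have "(T has_vector_derivative cadjoint (T' \<mu>)) (at \<mu>)"
    by (rule has_vector_derivative_transform_within_open[of _ _ _ "{a<..<b}"]) (use assms(2) herm in auto)
  then show ?thesis
    unfolding hermitian_def using T by (rule vector_derivative_unique_at)
qed

locale simple_nep =
  fixes a b lam :: real
    and T T' :: "real \<Rightarrow> complex ^ 'n ^ 'n"
    and \<rho> :: "complex ^ 'n \<Rightarrow> real"
    and v :: "complex ^ 'n"
  assumes nep: "hermitian_nep a b T T'"
    and rayleigh: "rayleigh_functional a b T \<rho>"
    and simple: "simple_eigenpair a b T lam v"
    and normalized: "cip v (T' lam *v v) = 1"
begin

section \<open>Elementary facts on the eigenpair and the Rayleigh functional; the bordered
  system\<close>

lemma lam_in: "lam \<in> {a<..<b}" and v_nonzero: "v \<noteq> 0" and T_lam_v: "T lam *v v = 0"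
  using simple by (auto simp: simple_eigenpair_def eigenpair_def)

lemma hermitian_T: "\<mu> \<in> {a<..<b} \<Longrightarrow> hermitian (T \<mu>)"
  using nep by (auto simp: hermitian_nep_def)

lemma hermitian_T': "\<mu> \<in> {a<..<b} \<Longrightarrow> hermitian (T' \<mu>)"
  using nep by (rule hermitian_nep_derivative)

lemma rho_in: "x \<noteq> 0 \<Longrightarrow> \<rho> x \<in> {a<..<b}"
  and rho_root: "x \<noteq> 0 \<Longrightarrow> cip x (T (\<rho> x) *v x) = 0"
  and rho_unique: "x \<noteq> 0 \<Longrightarrow> \<mu> \<in> {a<..<b} \<Longrightarrow> cip x (T \<mu> *v x) = 0 \<Longrightarrow> \<mu> = \<rho> x"
  using rayleigh by (auto simp: rayleigh_functional_def)

lemma rho_v: "\<rho> v = lam"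
  using rho_unique[OF v_nonzero lam_in] by (simp add: T_lam_v)

text \<open>The quadratic form only picks up the factor \<open>cnj \<beta> * \<beta>\<close>, so its
  root is unchanged. This reduces iterates \<open>\<beta> *s (v + w)\<close> to
  \<open>v + w\<close>.\<close>

lemma rho_smult:
  assumes "\<beta> \<noteq> 0" "x \<noteq> 0"
  shows "\<rho> (\<beta> *s x) = \<rho> x"
  using rho_unique[of "\<beta> *s x" "\<rho> x"] rho_in[OF assms(2)] rho_root[OF assms(2)] assms
  by (simp add: matrix_vector_mult_smult cip_smult_left cip_smult_right)

text \<open>The null space has dimension 1, and any independent set of that cardinality inside it
  spans it.\<close>

lemma null_space_span:
  assumes "T lam *v u = 0"
  shows "\<exists>\<beta>. u = \<beta> *s v"
proof -
  let ?N = "{u. T lam *v u = 0}"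
  have "vec.independent {v}"
    using v_nonzero by (simp add: vec.independent_insert vec.dependent_single)
  then have "?N \<subseteq> vec.span {v}"
    using simple T_lam_v by (intro vec.card_ge_dim_independent) (auto simp: simple_eigenpair_def)
  then show ?thesis
    using assms by (auto simp: vec.span_singleton)
qed

text \<open>The bordered map is linear on a finite-dimensional space, so injectivity yields a
  positive lower bound. Injectivity is where simplicity of the eigenvalue enters.\<close>

lemma bordered_bounded_below:
  "\<exists>\<kappa>>0. \<forall>u \<alpha>. \<kappa> * norm (u, \<alpha>) \<le> norm (T lam *v u - \<alpha> *s (T' lam *v v)) + cmod (cip v (T' lam *v u))"
proof -
  define f where "f = (\<lambda>(u, \<alpha>). (T lam *v u - \<alpha> *s (T' lam *v v), cip v (T' lam *v u)))"
  have "linear f"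
    by (intro linearI)
      (auto simp: f_def matrix_vector_right_distrib cip_add_right cip_smult_right scaleR_eq_smult
        vector_smult_assoc matrix_vector_mult_smult scaleR_conv_of_real vec_eq_iff algebra_simps)
  moreover have "p = 0" if "f p = 0" for p
  proof -
    obtain u \<alpha> where p: "p = (u, \<alpha>)" by (cases p)
    have eq: "T lam *v u = \<alpha> *s (T' lam *v v)" and vu: "cip v (T' lam *v u) = 0"
      using that by (auto simp: f_def p zero_prod_def)
    \<comment> \<open>Pairing the first equation with \<open>v\<close> isolates
      \<open>\<alpha>\<close>, and the pairing vanishes because \<open>T lam\<close> is Hermitian
      and annihilates \<open>v\<close>.\<close>
    have "\<alpha> = cip v (T lam *v u)"
      by (simp add: eq cip_smult_right normalized)
    also have "\<dots> = 0"
      by (simp add: hermitian_cip[OF hermitian_T[OF lam_in]] T_lam_v)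
    finally have "\<alpha> = 0" .
    moreover obtain \<beta> where "u = \<beta> *s v"
      using null_space_span[of u] eq \<open>\<alpha> = 0\<close> by auto
    ultimately show ?thesis
      using vu by (simp add: p zero_prod_def matrix_vector_mult_smult cip_smult_right normalized)
  qed
  ultimately obtain \<kappa> where k: "\<kappa> > 0" "\<And>p. \<kappa> * norm p \<le> norm (f p)"
    using linear_inj_bounded_below_pos[of f] linear_injective_0[of f] by blast
  have "\<kappa> * norm (u, \<alpha>) \<le> norm (T lam *v u - \<alpha> *s (T' lam *v v)) + cmod (cip v (T' lam *v u))" for u \<alpha>
    using k(2)[of "(u, \<alpha>)"] norm_Pair_le[of "T lam *v u - \<alpha> *s (T' lam *v v)" "cip v (T' lam *v u)"]
    by (simp add: f_def)
  then show ?thesis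
    using k(1) by blast
qed

text \<open>A mean value estimate on the segment from \<open>lam\<close> to \<open>\<mu>\<close>.
  The bound \<open>e\<close> on the variation of \<open>T'\<close> stays abstract: it comes from
  continuity in one use and from the Hoelder condition in the other.\<close>

lemma T_linearization:
  assumes "\<And>\<theta>. \<bar>\<theta> - lam\<bar> \<le> \<bar>\<mu> - lam\<bar> \<Longrightarrow> \<theta> \<in> {a<..<b} \<and> norm (T' \<theta> - T' lam) \<le> e"
  shows "norm (T \<mu> - T lam - (\<mu> - lam) *\<^sub>R T' lam) \<le> \<bar>\<mu> - lam\<bar> * e"
proof -
  have seg: "\<bar>\<theta> - lam\<bar> \<le> \<bar>\<mu> - lam\<bar>" if "\<theta> \<in> closed_segment lam \<mu>" for \<theta>
    using that by (auto simp: closed_segment_eq_real_ivl split: if_splits)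
  have "(T has_vector_derivative T' \<theta>) (at \<theta> within closed_segment lam \<mu>)" if "\<theta> \<in> closed_segment lam \<mu>" for \<theta>
    using nep assms[OF seg[OF that]]
    by (auto simp: hermitian_nep_def intro: has_vector_derivative_at_within)
  from vector_differentiable_bound_linearization[OF this, of lam \<mu> lam e] seg assms
  show ?thesis by auto
qed


section \<open>Limits at the eigenpair\<close>

text \<open>The filter \<open>nhds 0\<close> includes \<open>w = 0\<close>, so an iterate that is
  already a multiple of \<open>v\<close> needs no separate treatment.\<close>

lemma tendsto_rho: "((\<lambda>w. \<rho> (v + w)) \<longlongrightarrow> lam) (nhds 0)"
proof -
  have "isCont \<rho> v"
    using rayleigh v_nonzero
    by (simp add: rayleigh_functional_def continuous_on_eq_continuous_at[of "- {0}"] open_Compl)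
  moreover have "((\<lambda>w. v + w) \<longlongrightarrow> v + 0) (nhds 0)"
    by (intro tendsto_intros) (simp add: filterlim_ident)
  ultimately show ?thesis
    using isCont_tendsto_compose[of v \<rho> "\<lambda>w. v + w" "nhds 0"] by (simp add: rho_v)
qed

lemma tendsto_T: "(T \<longlongrightarrow> T lam) (nhds lam)" and tendsto_T': "(T' \<longlongrightarrow> T' lam) (nhds lam)"
proof -
  have "isCont T lam" "isCont T' lam"
    using nep lam_in
    by (auto simp: hermitian_nep_def continuous_on_eq_continuous_at intro: has_vector_derivative_continuous)
  then show "(T \<longlongrightarrow> T lam) (nhds lam)" "(T' \<longlongrightarrow> T' lam) (nhds lam)"
    by (simp_all add: isCont_def tendsto_nhds_iff)
qed

lemma tendsto_add_w: "((\<lambda>w. v + w) \<longlongrightarrow> v) (nhds 0)"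
  using tendsto_add[OF tendsto_const[of v] filterlim_ident[of "nhds (0 :: complex ^ 'n)"]] by simp

lemma tendsto_T_rho: "((\<lambda>w. T (\<rho> (v + w))) \<longlongrightarrow> T lam) (nhds 0)"
  by (rule filterlim_compose[OF tendsto_T tendsto_rho])

lemma tendsto_T'_rho: "((\<lambda>w. T' (\<rho> (v + w)) *v (v + w)) \<longlongrightarrow> T' lam *v v) (nhds 0)"
  by (rule tendsto_matrix_vector_mult[OF filterlim_compose[OF tendsto_T' tendsto_rho] tendsto_add_w])

section \<open>Orders of the Rayleigh functional error and of the residuals\<close>

lemma eventually_norm_diff_le:
  fixes f :: "'b \<Rightarrow> 'c :: real_normed_vector"
  assumes "(f \<longlongrightarrow> l) F" "e > 0"
  shows "\<forall>\<^sub>F w in F. norm (f w - l) \<le> e"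
  using tendstoD[OF assms] by (rule eventually_mono) (simp add: dist_norm)

text \<open>Since \<open>x\<^sup>* T(\<rho> x) x = 0\<close> and \<open>x\<^sup>* T(\<lambda>) x = w\<^sup>* T(\<lambda>) w\<close>, the error of the Rayleigh functional is
  quadratic in \<open>w\<close>.\<close>

lemma rho_error:
  "\<exists>K>0. \<forall>\<^sub>F w in nhds 0. v + w \<noteq> 0 \<and>
     \<bar>\<rho> (v + w) - lam\<bar> \<le> K * (norm w)\<^sup>2 \<and>
     norm (T (\<rho> (v + w)) - T lam) \<le> K * \<bar>\<rho> (v + w) - lam\<bar>"
proof -
  let ?T0 = "T lam" and ?D0 = "T' lam" and ?V = "norm v"
  have V: "?V > 0" using v_nonzero by simp
  \<comment> \<open>Chosen so that, with \<open>norm x\<close> at most twice \<open>norm v\<close>,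
    the linearization error contributes at most a quarter of the eigenvalue error.\<close>
  define e where "e = 1 / (16 * ?V\<^sup>2)"
  have e: "e > 0" using V by (simp add: e_def)
  have "\<forall>\<^sub>F \<theta> in nhds lam. \<theta> \<in> {a<..<b} \<and> norm (T' \<theta> - ?D0) \<le> e"
    using eventually_norm_diff_le[OF tendsto_T' e] eventually_nhds_in_open[of "{a<..<b}" lam] lam_in
    by (auto elim: eventually_elim2)
  then obtain d where d: "d > 0"
    "\<And>\<theta>. \<bar>\<theta> - lam\<bar> < d \<Longrightarrow> \<theta> \<in> {a<..<b} \<and> norm (T' \<theta> - ?D0) \<le> e"
    unfolding eventually_nhds_metric by (auto simp: dist_real_def)
  define K where "K = 2 * norm ?T0 + norm ?D0 + e + 1"
  have "K > 0" using e by (auto simp: K_def intro: add_nonneg_pos)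
  have "((\<lambda>w. cip (v + w) (?D0 *v (v + w))) \<longlongrightarrow> cip v (?D0 *v v)) (nhds 0)"
    by (intro tendsto_cip tendsto_matrix_vector_mult tendsto_add_w tendsto_const)
  then have ev1: "\<forall>\<^sub>F w in nhds 0. norm (cip (v + w) (?D0 *v (v + w)) - 1) \<le> 1 / 4"
    by (intro eventually_norm_diff_le) (auto simp: normalized)
  have ev2: "\<forall>\<^sub>F w in nhds 0. norm ((v + w) - v) \<le> ?V / 2"
    using V by (intro eventually_norm_diff_le tendsto_add_w) auto
  have ev3: "\<forall>\<^sub>F w in nhds 0. \<bar>\<rho> (v + w) - lam\<bar> < d"
    using tendstoD[OF tendsto_rho d(1)] by (simp add: dist_real_def)
  have "\<forall>\<^sub>F w in nhds 0. v + w \<noteq> 0 \<and> \<bar>\<rho> (v + w) - lam\<bar> \<le> K * (norm w)\<^sup>2 \<and>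
     norm (T (\<rho> (v + w)) - T lam) \<le> K * \<bar>\<rho> (v + w) - lam\<bar>"
    using ev1 ev2 ev3
  proof eventually_elim
    case (elim w)
    define x where "x = v + w"
    define \<mu> where "\<mu> = \<rho> x"
    define E where "E = T \<mu> - ?T0 - (\<mu> - lam) *\<^sub>R ?D0"
    have w: "norm w \<le> ?V / 2" using elim by simp
    have x0: "x \<noteq> 0"
      using w V unfolding x_def by (metis add_eq_0_iff field_sum_of_halves less_add_same_cancel1 norm_minus_cancel not_le zero_less_divide_iff zero_less_numeral)
    have nx: "norm x \<le> 2 * ?V"
      using norm_triangle_ineq[of v w] w V unfolding x_def by linarith
    have E: "norm E \<le> \<bar>\<mu> - lam\<bar> * e"
      unfolding E_def by (rule T_linearization) (use elim d(2) in \<open>auto simp: \<mu>_def x_def\<close>)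
    have T\<mu>: "T \<mu> = ?T0 + (\<mu> - lam) *\<^sub>R ?D0 + E"
      by (simp add: E_def)
    have "0 = cip x (T \<mu> *v x)"
      using rho_root[OF x0] by (simp add: \<mu>_def)
    also have "\<dots> = cip x (?T0 *v x) + complex_of_real (\<mu> - lam) * cip x (?D0 *v x) + cip x (E *v x)"
      by (simp add: T\<mu> matrix_vector_mult_add_rdistrib matrix_scaleR_vector cip_add_right
          cip_diff_right cip_smult_right left_diff_distrib)
    also have "cip x (?T0 *v x) = cip w (?T0 *v w)"
      by (simp add: x_def matrix_vector_right_distrib T_lam_v cip_add_left
          hermitian_cip[OF hermitian_T[OF lam_in], of v])
    \<comment> \<open>The expansion of the root condition, solved for the eigenvalue error; only
      \<open>w\<close> remains in the term with \<open>T lam\<close>.\<close>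
    finally have eq: "complex_of_real (\<mu> - lam) * cip x (?D0 *v x) = - (cip w (?T0 *v w) + cip x (E *v x))"
      by (simp add: eq_neg_iff_add_eq_0 algebra_simps)
    have "1 - 1 / 4 \<le> cmod (cip x (?D0 *v x))"
      using elim(1) norm_triangle_ineq3[of "cip x (?D0 *v x)" 1] by (simp add: x_def)
    then have "\<bar>\<mu> - lam\<bar> * (3 / 4) \<le> \<bar>\<mu> - lam\<bar> * cmod (cip x (?D0 *v x))"
      by (intro mult_left_mono) auto
    also have "\<dots> = cmod (cip w (?T0 *v w) + cip x (E *v x))"
      by (metis eq norm_minus_cancel norm_mult norm_of_real)
    also have "\<dots> \<le> norm w * (norm ?T0 * norm w) + norm x * (norm E * norm x)"
      by (intro norm_triangle_mono order_trans[OF cmod_cip_le] mult_left_mono norm_matrix_vector_le) auto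
    also have "norm x * (norm E * norm x) \<le> (2 * ?V) * ((\<bar>\<mu> - lam\<bar> * e) * (2 * ?V))"
      using nx E e by (intro mult_mono) auto
    also have "(2 * ?V) * ((\<bar>\<mu> - lam\<bar> * e) * (2 * ?V)) = \<bar>\<mu> - lam\<bar> / 4"
      using V by (simp add: e_def power2_eq_square)
    \<comment> \<open>Three quarters on the left minus the absorbed quarter leave one half, whence
      the factor 2.\<close>
    finally have "\<bar>\<mu> - lam\<bar> \<le> 2 * norm ?T0 * (norm w)\<^sup>2"
      by (simp add: power2_eq_square algebra_simps)
    also have "\<dots> \<le> K * (norm w)\<^sup>2"
      using e by (intro mult_right_mono) (auto simp: K_def)
    finally have 1: "\<bar>\<mu> - lam\<bar> \<le> K * (norm w)\<^sup>2" .
    have "norm (T \<mu> - ?T0) = norm ((\<mu> - lam) *\<^sub>R ?D0 + E)"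
      by (simp add: E_def)
    also have "\<dots> \<le> \<bar>\<mu> - lam\<bar> * norm ?D0 + \<bar>\<mu> - lam\<bar> * e"
      using E by (intro norm_triangle_mono) auto
    also have "\<dots> = (norm ?D0 + e) * \<bar>\<mu> - lam\<bar>"
      by (simp add: algebra_simps)
    also have "\<dots> \<le> K * \<bar>\<mu> - lam\<bar>"
      by (intro mult_right_mono) (auto simp: K_def intro: add_nonneg_nonneg)
    finally show ?case
      using 1 x0 by (simp add: x_def \<mu>_def)
  qed
  then show ?thesis
    using \<open>K > 0\<close> by blast
qed

text \<open>Since \<open>T lam\<close> annihilates \<open>v\<close>, only the change of
  \<open>T\<close> acts on \<open>v\<close>, and it is quadratic in \<open>w\<close> by the Rayleigh
  functional estimate; the action on \<open>w\<close> is of first order.\<close>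

lemma residual_error:
  "\<exists>K>0. \<forall>\<^sub>F w in nhds 0. norm (T (\<rho> (v + w)) *v (v + w)) \<le> K * norm w \<and>
     norm (T (\<rho> (v + w)) *v v) \<le> K * (norm w)\<^sup>2"
proof -
  let ?V = "norm v"
  obtain K where K: "K > 0" and ev: "\<forall>\<^sub>F w in nhds 0. v + w \<noteq> 0 \<and>
     \<bar>\<rho> (v + w) - lam\<bar> \<le> K * (norm w)\<^sup>2 \<and> norm (T (\<rho> (v + w)) - T lam) \<le> K * \<bar>\<rho> (v + w) - lam\<bar>"
    using rho_error by blast
  \<comment> \<open>For \<open>norm w\<close> at most 1 higher powers are absorbed into lower
    ones.\<close>
  have ev2: "\<forall>\<^sub>F w in nhds 0. norm (w - 0) \<le> (1 :: real)"
    by (intro eventually_norm_diff_le filterlim_ident) auto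
  define L where "L = K * K * ?V + K * K + norm (T lam) + 1"
  have V: "?V > 0" using v_nonzero by simp
  have L: "L > 0" using K V by (auto simp: L_def intro!: add_nonneg_pos)
  have "\<forall>\<^sub>F w in nhds 0. norm (T (\<rho> (v + w)) *v (v + w)) \<le> L * norm w \<and>
     norm (T (\<rho> (v + w)) *v v) \<le> L * (norm w)\<^sup>2"
    using ev ev2
  proof eventually_elim
    case (elim w)
    define \<mu> where "\<mu> = \<rho> (v + w)"
    have w: "norm w \<le> 1" using elim by simp
    then have w2: "(norm w)\<^sup>2 \<le> norm w"
      by (simp add: power2_eq_square mult_left_le)
    have "norm (T \<mu> - T lam) \<le> K * \<bar>\<mu> - lam\<bar>"
      using elim by (simp add: \<mu>_def)
    also have "\<dots> \<le> K * (K * (norm w)\<^sup>2)"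
      using elim K by (intro mult_left_mono) (auto simp: \<mu>_def)
    finally have d: "norm (T \<mu> - T lam) \<le> K * K * (norm w)\<^sup>2" by simp
    have "T \<mu> *v v = (T \<mu> - T lam) *v v"
      by (simp add: matrix_vector_mult_diff_rdistrib T_lam_v)
    then have "norm (T \<mu> *v v) \<le> norm (T \<mu> - T lam) * ?V"
      by (simp add: norm_matrix_vector_le)
    also have "\<dots> \<le> K * K * (norm w)\<^sup>2 * ?V"
      by (intro mult_right_mono d) auto
    finally have Tv: "norm (T \<mu> *v v) \<le> K * K * ?V * (norm w)\<^sup>2"
      by (simp add: mult_ac)
    have "T \<mu> *v w = (T \<mu> - T lam) *v w + T lam *v w"
      by (simp add: matrix_vector_mult_diff_rdistrib)
    then have "norm (T \<mu> *v w) \<le> norm (T \<mu> - T lam) * norm w + norm (T lam) * norm w"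
      by (simp add: norm_triangle_mono norm_matrix_vector_le)
    also have "\<dots> \<le> K * K * norm w + norm (T lam) * norm w"
    proof -
      have "K * K * (norm w)\<^sup>2 * norm w \<le> K * K * 1 * norm w"
        using w K by (intro mult_right_mono mult_left_mono) (auto simp: power2_eq_square mult_le_one)
      with d show ?thesis
        by (smt (verit) mult_right_mono norm_ge_zero mult_1_right)
    qed
    finally have Tw: "norm (T \<mu> *v w) \<le> (K * K + norm (T lam)) * norm w"
      by (simp add: algebra_simps)
    have "norm (T \<mu> *v (v + w)) \<le> K * K * ?V * (norm w)\<^sup>2 + (K * K + norm (T lam)) * norm w"
      unfolding matrix_vector_right_distrib by (intro norm_triangle_mono Tv Tw)
    also have "\<dots> \<le> K * K * ?V * norm w + (K * K + norm (T lam)) * norm w"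
      using w2 K by (intro add_right_mono mult_left_mono) auto
    also have "\<dots> \<le> L * norm w"
      by (simp add: L_def algebra_simps)
    finally have 1: "norm (T \<mu> *v (v + w)) \<le> L * norm w" .
    have "K * K * ?V * (norm w)\<^sup>2 \<le> L * (norm w)\<^sup>2"
      using K by (intro mult_right_mono) (auto simp: L_def)
    then show ?case
      using 1 Tv by (simp add: \<mu>_def)
  qed
  then show ?thesis
    using L by blast
qed

text \<open>Subtracting this multiple of the border vector removes the first-order term of
  \<open>T\<close> at \<open>lam\<close>. What remains is the linearization error, of order 3/2 in
  the eigenvalue error, and the eigenvalue error times the first-order change of the border vector;
  both are cubic in \<open>w\<close>.\<close>

lemma hoelder_residual_error:
  assumes "half_hoelder_at T' lam"
  shows "\<exists>K>0. \<forall>\<^sub>F w in nhds 0. norm (T (\<rho> (v + w)) *v v -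
     complex_of_real (\<rho> (v + w) - lam) *s (T' (\<rho> (v + w)) *v (v + w))) \<le> K * (norm w) ^ 3"
proof -
  let ?D0 = "T' lam" and ?V = "norm v"
  have V: "?V > 0" using v_nonzero by simp
  obtain K where K: "K > 0" and ev: "\<forall>\<^sub>F w in nhds 0. v + w \<noteq> 0 \<and>
     \<bar>\<rho> (v + w) - lam\<bar> \<le> K * (norm w)\<^sup>2 \<and> norm (T (\<rho> (v + w)) - T lam) \<le> K * \<bar>\<rho> (v + w) - lam\<bar>"
    using rho_error by blast
  obtain L where "\<forall>\<^sub>F \<theta> in at lam. norm (T' \<theta> - ?D0) \<le> L * sqrt \<bar>\<theta> - lam\<bar>"
    using assms by (auto simp: half_hoelder_at_def)
  then have "\<forall>\<^sub>F \<theta> in nhds lam. norm (T' \<theta> - ?D0) \<le> L * sqrt \<bar>\<theta> - lam\<bar>"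
    \<comment> \<open>At \<open>lam\<close> itself both sides are 0, so the punctured neighbourhood
      can be filled.\<close>
    by (rule eventually_nhds_conv_at[THEN iffD2, OF conjI]) simp
  then have "\<forall>\<^sub>F \<theta> in nhds lam. \<theta> \<in> {a<..<b} \<and> norm (T' \<theta> - ?D0) \<le> L * sqrt \<bar>\<theta> - lam\<bar>"
    using eventually_nhds_in_open[of "{a<..<b}" lam] lam_in by (auto elim: eventually_elim2)
  then obtain d where d: "d > 0"
    "\<And>\<theta>. \<bar>\<theta> - lam\<bar> < d \<Longrightarrow> \<theta> \<in> {a<..<b} \<and> norm (T' \<theta> - ?D0) \<le> L * sqrt \<bar>\<theta> - lam\<bar>"
    unfolding eventually_nhds_metric by (auto simp: dist_real_def)
  \<comment> \<open>The Hoelder bound expressed in \<open>norm w\<close>, through the root of the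
    quadratic estimate. The sign of \<open>L\<close> is unknown, hence the absolute value.\<close>
  define H where "H = \<bar>L\<bar> * sqrt K"
  have H: "H \<ge> 0" using K by (simp add: H_def)
  have ev2: "\<forall>\<^sub>F w in nhds 0. norm ((v + w) - v) \<le> ?V"
    using V by (intro eventually_norm_diff_le tendsto_add_w) auto
  have ev3: "\<forall>\<^sub>F w in nhds 0. \<bar>\<rho> (v + w) - lam\<bar> < d"
    using tendstoD[OF tendsto_rho d(1)] by (simp add: dist_real_def)
  define B where "B = K * H * ?V + K * (H * (2 * ?V) + norm ?D0) + 1"
  have B: "B > 0" using K H by (auto simp: B_def intro!: add_nonneg_pos add_nonneg_nonneg)
  have "\<forall>\<^sub>F w in nhds 0. norm (T (\<rho> (v + w)) *v v -
     complex_of_real (\<rho> (v + w) - lam) *s (T' (\<rho> (v + w)) *v (v + w))) \<le> B * (norm w) ^ 3"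
    using ev ev2 ev3
  proof eventually_elim
    case (elim w)
    define x where "x = v + w"
    define \<mu> where "\<mu> = \<rho> x"
    define E where "E = T \<mu> - T lam - (\<mu> - lam) *\<^sub>R ?D0"
    have rho: "\<bar>\<mu> - lam\<bar> \<le> K * (norm w)\<^sup>2" using elim by (simp add: \<mu>_def x_def)
    have nx: "norm x \<le> 2 * ?V"
      using norm_triangle_ineq[of v w] elim by (simp add: x_def)
    have "sqrt \<bar>\<mu> - lam\<bar> \<le> sqrt (K * (norm w)\<^sup>2)"
      using rho by simp
    also have "\<dots> = sqrt K * norm w"
      by (simp add: real_sqrt_mult)
    finally have sq: "sqrt \<bar>\<mu> - lam\<bar> \<le> sqrt K * norm w" .
    have T': "norm (T' \<theta> - ?D0) \<le> H * norm w" if "\<theta> \<in> {a<..<b} \<and> norm (T' \<theta> - ?D0) \<le> L * sqrt \<bar>\<theta> - lam\<bar>"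
      "\<bar>\<theta> - lam\<bar> \<le> \<bar>\<mu> - lam\<bar>" for \<theta>
    proof -
      have "L * sqrt \<bar>\<theta> - lam\<bar> \<le> \<bar>L\<bar> * sqrt \<bar>\<mu> - lam\<bar>"
        using that by (intro mult_mono) auto
      also have "\<dots> \<le> \<bar>L\<bar> * (sqrt K * norm w)"
        by (intro mult_left_mono sq) auto
      finally show ?thesis
        using that by (simp add: H_def mult_ac)
    qed
    have loc: "\<bar>\<theta> - lam\<bar> < d" if "\<bar>\<theta> - lam\<bar> \<le> \<bar>\<mu> - lam\<bar>" for \<theta>
      using that elim by (simp add: \<mu>_def x_def)
    have "norm E \<le> \<bar>\<mu> - lam\<bar> * (H * norm w)"
      unfolding E_def by (rule T_linearization) (use d(2)[OF loc] T'[OF d(2)[OF loc]] in auto)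
    also have "\<dots> \<le> K * (norm w)\<^sup>2 * (H * norm w)"
      using H by (intro mult_right_mono rho) auto
    finally have E: "norm E \<le> K * H * (norm w) ^ 3"
      by (simp add: power3_eq_cube power2_eq_square mult_ac)
    have "?D0 *v v - T' \<mu> *v x = (?D0 - T' \<mu>) *v x - ?D0 *v w"
      by (simp add: x_def matrix_vector_mult_diff_rdistrib matrix_vector_right_distrib)
    also have "norm \<dots> \<le> norm (?D0 - T' \<mu>) * norm x + norm ?D0 * norm w"
      by (intro order_trans[OF norm_triangle_ineq4] add_mono norm_matrix_vector_le)
    also have "\<dots> \<le> (H * norm w) * (2 * ?V) + norm ?D0 * norm w"
      using T'[OF d(2)[OF loc], of \<mu>] nx H by (intro add_mono mult_mono) (auto simp: norm_minus_commute)
    finally have D: "norm (?D0 *v v - T' \<mu> *v x) \<le> (H * (2 * ?V) + norm ?D0) * norm w"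
      by (simp add: algebra_simps)
    have eq: "T \<mu> *v v - complex_of_real (\<mu> - lam) *s (T' \<mu> *v x)
        = E *v v + complex_of_real (\<mu> - lam) *s (?D0 *v v - T' \<mu> *v x)"
      by (simp add: E_def matrix_vector_mult_diff_rdistrib T_lam_v matrix_scaleR_vector vector_ssub_ldistrib)
    have "norm (E *v v) \<le> (K * H * (norm w) ^ 3) * ?V"
      by (intro order_trans[OF norm_matrix_vector_le] mult_right_mono E) auto
    moreover have "norm (complex_of_real (\<mu> - lam) *s (?D0 *v v - T' \<mu> *v x))
        \<le> (K * (norm w)\<^sup>2) * ((H * (2 * ?V) + norm ?D0) * norm w)"
      unfolding norm_smult norm_of_real using rho D K by (intro mult_mono) auto
    ultimately have "norm (T \<mu> *v v - complex_of_real (\<mu> - lam) *s (T' \<mu> *v x))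
        \<le> (K * H * (norm w) ^ 3) * ?V + (K * (norm w)\<^sup>2) * ((H * (2 * ?V) + norm ?D0) * norm w)"
      unfolding eq by (rule norm_triangle_mono)
    also have "\<dots> = (B - 1) * (norm w) ^ 3"
      by (simp add: B_def power3_eq_cube power2_eq_square algebra_simps)
    also have "\<dots> \<le> B * (norm w) ^ 3"
      by (intro mult_right_mono) auto
    finally show ?case
      by (simp add: \<mu>_def x_def)
  qed
  then show ?thesis
    using B by blast
qed


section \<open>From the bordered system to the angle of the update\<close>

text \<open>The exact solution of the bordered system would be a multiple of \<open>v\<close> up to the error
  \<open>T(\<mu>) v - \<beta> T'(\<mu>) x\<close>, and the border absorbs any multiple of \<open>T'(\<mu>) x\<close>; hence \<open>\<beta>\<close> is arbitrary.\<close>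

lemma update_error:
  "\<exists>K>0. \<forall>\<^sub>F w in nhds 0. \<forall>y q \<alpha> \<beta>.
     (let x = v + w; \<mu> = \<rho> x in
       T \<mu> *v y = q + \<alpha> *s (T' \<mu> *v x) \<longrightarrow> cip x (T' \<mu> *v y) = cip x (T' \<mu> *v x) \<longrightarrow>
       y \<noteq> 0 \<and> sin (vec_angle v y) \<le> K * (norm q + norm (T \<mu> *v v - \<beta> *s (T' \<mu> *v x))))"
proof -
  let ?T0 = "T lam" and ?D0 = "T' lam" and ?V = "norm v"
  have V: "?V > 0" using v_nonzero by simp
  obtain \<kappa> where k: "\<kappa> > 0" "\<And>u \<alpha>. \<kappa> * norm (u, \<alpha>) \<le> norm (?T0 *v u - \<alpha> *s (?D0 *v v)) + cmod (cip v (?D0 *v u))"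
    using bordered_bounded_below by blast
  \<comment> \<open>Two perturbations of size \<open>\<kappa> / 6\<close> in the first component of
    the bordered system and one in the second use up half of the lower bound
    \<open>\<kappa>\<close>.\<close>
  have ev1: "\<forall>\<^sub>F w in nhds 0. norm (T (\<rho> (v + w)) - ?T0) \<le> \<kappa> / 6"
    using k by (intro eventually_norm_diff_le tendsto_T_rho) auto
  have ev2: "\<forall>\<^sub>F w in nhds 0. norm (T' (\<rho> (v + w)) *v (v + w) - ?D0 *v v) \<le> \<kappa> / 6"
    using k by (intro eventually_norm_diff_le tendsto_T'_rho) auto
  have "((\<lambda>w. cip (v + w) (T' (\<rho> (v + w)) *v (v + w))) \<longlongrightarrow> cip v (?D0 *v v)) (nhds 0)"
    by (intro tendsto_cip tendsto_T'_rho tendsto_add_w)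
  then have ev3: "\<forall>\<^sub>F w in nhds 0. norm (cip (v + w) (T' (\<rho> (v + w)) *v (v + w)) - 1) \<le> 1 / 4"
    by (intro eventually_norm_diff_le) (auto simp: normalized)
  have "((\<lambda>w. cip (v + w) (T' (\<rho> (v + w)) *v v)) \<longlongrightarrow> cip v (?D0 *v v)) (nhds 0)"
    by (intro tendsto_cip tendsto_matrix_vector_mult filterlim_compose[OF tendsto_T' tendsto_rho]
        tendsto_add_w tendsto_const)
  then have ev4: "\<forall>\<^sub>F w in nhds 0. norm (cip (v + w) (T' (\<rho> (v + w)) *v v) - 1) \<le> 1 / 4"
    by (intro eventually_norm_diff_le) (auto simp: normalized)
  \<comment> \<open>The factor 2 for dividing by \<open>\<theta>\<close>, the factor 2 for the
    right-hand side, and \<open>2 / \<kappa>\<close> for the inverse multiply to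
    \<open>8 / \<kappa>\<close>; \<open>norm v\<close> comes from the sine.\<close>
  define K where "K = 8 / (\<kappa> * ?V)"
  have K: "K > 0" using k V by (simp add: K_def)
  have ev5: "\<forall>\<^sub>F w in nhds 0. v + w \<noteq> 0"
    using rho_error by (auto elim: eventually_mono)
  have "\<forall>\<^sub>F w in nhds 0. \<forall>y q \<alpha> \<beta>. (let x = v + w; \<mu> = \<rho> x in
       T \<mu> *v y = q + \<alpha> *s (T' \<mu> *v x) \<longrightarrow> cip x (T' \<mu> *v y) = cip x (T' \<mu> *v x) \<longrightarrow>
       y \<noteq> 0 \<and> sin (vec_angle v y) \<le> K * (norm q + norm (T \<mu> *v v - \<beta> *s (T' \<mu> *v x))))"
    using ev1 ev2 ev3 ev4 ev5
  proof eventually_elim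
    case (elim w)
    define x where "x = v + w"
    define \<mu> where "\<mu> = \<rho> x"
    show ?case
      unfolding Let_def x_def[symmetric] \<mu>_def[symmetric]
    proof (intro allI impI)
      fix y q \<alpha> \<beta>
      assume Ty: "T \<mu> *v y = q + \<alpha> *s (T' \<mu> *v x)" and xy: "cip x (T' \<mu> *v y) = cip x (T' \<mu> *v x)"
      let ?E = "T \<mu> *v v - \<beta> *s (T' \<mu> *v x)"
      have x0: "x \<noteq> 0" using elim by (simp add: x_def)
      have xx: "cmod (cip x (T' \<mu> *v x) - 1) \<le> 1 / 4" and xv: "cmod (cip x (T' \<mu> *v v) - 1) \<le> 1 / 4"
        using elim by (simp_all add: x_def \<mu>_def)
      have xx': "3 / 4 \<le> cmod (cip x (T' \<mu> *v x))" "cmod (cip x (T' \<mu> *v x)) \<le> 5 / 4"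
        using norm_triangle_ineq3[of "cip x (T' \<mu> *v x)" 1] xx by auto
      have xv': "3 / 4 \<le> cmod (cip x (T' \<mu> *v v))" "cmod (cip x (T' \<mu> *v v)) \<le> 5 / 4"
        using norm_triangle_ineq3[of "cip x (T' \<mu> *v v)" 1] xv by auto
      \<comment> \<open>\<open>\<theta> *s v\<close> satisfies the same border condition as
        \<open>y\<close>, so the difference \<open>u\<close> satisfies the homogeneous one. The
        bounds 3/4 and 5/4 keep \<open>cmod \<theta>\<close> between 3/5 and 5/3.\<close>
      define \<theta> where "\<theta> = cip x (T' \<mu> *v x) / cip x (T' \<mu> *v v)"
      have \<theta>: "1 / 2 \<le> cmod \<theta>" "cmod \<theta> \<le> 2"
        unfolding \<theta>_def norm_divide using xx' xv'
        by (auto intro!: mult_imp_le_div_pos mult_imp_div_pos_le)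
      have xv0: "cip x (T' \<mu> *v v) \<noteq> 0" using xv' by auto
      have y0: "y \<noteq> 0" using xy xx' by auto
      define u where "u = y - \<theta> *s v"
      define \<alpha>' where "\<alpha>' = \<alpha> - \<theta> * \<beta>"
      have xu: "cip x (T' \<mu> *v u) = 0"
        using xv0 xy by (simp add: u_def matrix_vector_mult_diff_distrib matrix_vector_mult_smult
            cip_diff_right cip_smult_right \<theta>_def)
      have eq: "T \<mu> *v u - \<alpha>' *s (T' \<mu> *v x) = q - \<theta> *s ?E"
        by (simp add: u_def \<alpha>'_def matrix_vector_mult_diff_distrib matrix_vector_mult_smult Ty
            vec_eq_iff algebra_simps)
      let ?N = "norm (u, \<alpha>')"
      have N: "norm u \<le> ?N" "norm \<alpha>' \<le> ?N"
        by (simp_all add: norm_Pair real_le_rsqrt)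
      have h: "norm (T' \<mu> *v x - ?D0 *v v) \<le> \<kappa> / 6"
        using elim by (simp add: x_def \<mu>_def)
      have "?T0 *v u - \<alpha>' *s (?D0 *v v) = (T \<mu> *v u - \<alpha>' *s (T' \<mu> *v x))
          + (\<alpha>' *s (T' \<mu> *v x - ?D0 *v v) - (T \<mu> - ?T0) *v u)"
        by (simp add: matrix_vector_mult_diff_rdistrib vec_eq_iff algebra_simps)
      also have "norm \<dots> \<le> norm (T \<mu> *v u - \<alpha>' *s (T' \<mu> *v x))
          + (norm (\<alpha>' *s (T' \<mu> *v x - ?D0 *v v)) + norm ((T \<mu> - ?T0) *v u))"
        by (intro order_trans[OF norm_triangle_ineq] add_left_mono norm_triangle_ineq4)
      also have "\<dots> \<le> norm (q - \<theta> *s ?E) + (?N * (\<kappa> / 6) + (\<kappa> / 6) * ?N)"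
        unfolding eq norm_smult using elim N h k(1)
        by (intro add_left_mono add_mono mult_mono order_trans[OF norm_matrix_vector_le])
          (auto simp: x_def \<mu>_def)
      finally have 1: "norm (?T0 *v u - \<alpha>' *s (?D0 *v v)) \<le> norm (q - \<theta> *s ?E) + (\<kappa> / 3) * ?N"
        by (simp add: algebra_simps)
      \<comment> \<open>As the derivatives are Hermitian they move to the left argument, where the
        vanishing pairing \<open>cip x (T' \<mu> *v u)\<close> can be subtracted.\<close>
      have "cip v (?D0 *v u) = cip (?D0 *v v - T' \<mu> *v x) u"
        using xu hermitian_cip[OF hermitian_T'[OF lam_in], of v u]
          hermitian_cip[OF hermitian_T'[OF rho_in[OF x0]], of x u]
        by (simp add: cip_diff_left \<mu>_def)
      then have "cmod (cip v (?D0 *v u)) \<le> norm (?D0 *v v - T' \<mu> *v x) * norm u"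
        by (simp add: cmod_cip_le)
      also have "\<dots> \<le> (\<kappa> / 6) * ?N"
        using h N k(1) by (intro mult_mono) (auto simp: norm_minus_commute)
      finally have 2: "cmod (cip v (?D0 *v u)) \<le> (\<kappa> / 6) * ?N" .
      have "\<kappa> * ?N \<le> norm (q - \<theta> *s ?E) + (\<kappa> / 2) * ?N"
        using k(2)[of u \<alpha>'] 1 2 by linarith
      then have "(\<kappa> / 2) * ?N \<le> norm (q - \<theta> *s ?E)"
        by linarith
      also have "\<dots> \<le> norm q + cmod \<theta> * norm ?E"
        using norm_triangle_ineq4[of q "\<theta> *s ?E"] by (simp only: norm_smult)
      also have "\<dots> \<le> 2 * (norm q + norm ?E)"
        using mult_right_mono[OF \<theta>(2), of "norm ?E"] by (simp add: algebra_simps add_mono)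
      finally have bound: "(\<kappa> / 2) * ?N \<le> 2 * (norm q + norm ?E)" .
      have \<theta>0: "\<theta> \<noteq> 0" using \<theta> by auto
      \<comment> \<open>The distance from \<open>v\<close> to the line through \<open>y\<close> is
        at most that to the particular multiple by \<open>1 / \<theta>\<close>, which differs from
        \<open>v\<close> by a multiple of \<open>u\<close>.\<close>
      have "sin (vec_angle v y) * ?V \<le> norm (v - (1 / \<theta>) *s y)"
        using sin_vec_angle_le_dist[OF y0 v_nonzero] by (simp add: vec_angle_commute)
      also have "v - (1 / \<theta>) *s y = (- 1 / \<theta>) *s u"
        using \<theta>0 by (simp add: u_def vec_eq_iff field_simps)
      also have "norm \<dots> = norm u / cmod \<theta>"
        by (simp add: norm_smult norm_divide)
      also have "\<dots> \<le> 2 * norm u"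
        using \<theta>(1) \<theta>0 mult_right_mono[OF \<theta>(1), of "norm u"] by (simp add: pos_divide_le_eq mult_ac)
      also have "\<dots> \<le> 2 * ?N"
        using N by simp
      also have "\<dots> = (4 / \<kappa>) * ((\<kappa> / 2) * ?N)"
        using k(1) by simp
      also have "\<dots> \<le> (4 / \<kappa>) * (2 * (norm q + norm ?E))"
        using k(1) by (intro mult_left_mono bound) auto
      finally have "sin (vec_angle v y) \<le> K * (norm q + norm ?E)"
        using V k(1) by (simp add: K_def field_simps)
      then show "y \<noteq> 0 \<and> sin (vec_angle v y) \<le> K * (norm q + norm ?E)"
        using y0 by blast
    qed
  qed
  then show ?thesis
    using K by blast
qed

text \<open>Pairing with \<open>v\<close> through \<open>T' lam\<close> isolates the cosine part,
  and the rest is the sine part along the unit vector \<open>g\<close>. Both scale with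
  \<open>\<beta>\<close>, so the quotient depends on \<open>w\<close> alone.\<close>

lemma generalized_tangent_error:
  "\<exists>K>0. \<forall>\<^sub>F w in nhds 0. \<forall>\<beta> \<gamma> c t g. \<beta> \<noteq> 0 \<longrightarrow> generalized_decomp (T' lam) v (\<beta> *s (v + w)) \<gamma> c t g \<longrightarrow>
     cmod t / cmod c \<le> K * norm w"
proof -
  let ?D0 = "T' lam" and ?V = "norm v"
  define K where "K = 2 * (1 + norm ?D0 * ?V * ?V)"
  have K: "K > 0" by (simp add: K_def add_pos_nonneg)
  have "((\<lambda>w. cip v (?D0 *v (v + w))) \<longlongrightarrow> cip v (?D0 *v v)) (nhds 0)"
    by (intro tendsto_cip tendsto_matrix_vector_mult tendsto_add_w tendsto_const)
  then have ev1: "\<forall>\<^sub>F w in nhds 0. norm (cip v (?D0 *v (v + w)) - 1) \<le> 1 / 2"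
    by (intro eventually_norm_diff_le) (auto simp: normalized)
  have "\<forall>\<^sub>F w in nhds 0. \<forall>\<beta> \<gamma> c t g. \<beta> \<noteq> 0 \<longrightarrow> generalized_decomp ?D0 v (\<beta> *s (v + w)) \<gamma> c t g \<longrightarrow>
     cmod t / cmod c \<le> K * norm w"
    using ev1
  proof (eventually_elim, intro allI impI)
    fix w \<beta> \<gamma> c t g
    assume w: "norm (cip v (?D0 *v (v + w)) - 1) \<le> 1 / 2" and \<beta>: "\<beta> \<noteq> 0"
      and dec: "generalized_decomp ?D0 v (\<beta> *s (v + w)) \<gamma> c t g"
    let ?p = "cip v (?D0 *v w)" and ?g = "complex_of_real \<gamma>"
    have \<gamma>: "\<gamma> > 0" and x: "\<beta> *s (v + w) = ?g *s (c *s v + t *s g)"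
      and vg: "cip v (?D0 *v g) = 0" and ng: "norm g = 1"
      using dec by (auto simp: generalized_decomp_def scaleR_eq_smult)
    have vw: "cip v (?D0 *v (v + w)) = 1 + ?p"
      by (simp add: matrix_vector_right_distrib cip_add_right normalized)
    have "\<beta> * (1 + ?p) = cip v (?D0 *v (\<beta> *s (v + w)))"
      by (simp only: vw matrix_vector_mult_smult cip_smult_right)
    also have "\<dots> = ?g * c"
      unfolding x by (simp add: matrix_vector_right_distrib matrix_vector_mult_smult cip_add_right
          cip_smult_right normalized vg)
    finally have gc: "?g * c = \<beta> * (1 + ?p)" by simp
    have "(?g * t) *s g = \<beta> *s (v + w) - (?g * c) *s v"
      unfolding x by (simp add: vec_eq_iff algebra_simps)
    also have "\<dots> = \<beta> *s (w - ?p *s v)"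
      unfolding gc by (simp add: vec_eq_iff algebra_simps)
    finally have "norm ((?g * t) *s g) = norm (\<beta> *s (w - ?p *s v))" by simp
    then have gt: "\<gamma> * cmod t = cmod \<beta> * norm (w - ?p *s v)"
      unfolding norm_smult norm_mult using \<gamma> ng by simp
    have gc': "\<gamma> * cmod c = cmod \<beta> * cmod (1 + ?p)"
      using \<gamma> by (metis gc norm_mult norm_of_real abs_of_pos)
    have "cmod t / cmod c = (\<gamma> * cmod t) / (\<gamma> * cmod c)"
      using \<gamma> by simp
    also have "\<dots> = norm (w - ?p *s v) / cmod (1 + ?p)"
      unfolding gt gc' using \<beta> by simp
    also have "\<dots> \<le> norm (w - ?p *s v) / (1 / 2)"
      using w norm_triangle_ineq3[of "1 + ?p" 1] by (intro divide_left_mono) (auto simp: vw)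
    also have "\<dots> \<le> 2 * (norm w + cmod ?p * ?V)"
      using norm_triangle_ineq4[of w "?p *s v"] by (simp add: norm_smult)
    also have "\<dots> \<le> 2 * (norm w + (?V * (norm ?D0 * norm w)) * ?V)"
      by (intro mult_left_mono add_left_mono mult_right_mono order_trans[OF cmod_cip_le]
          norm_matrix_vector_le) auto
    also have "\<dots> = K * norm w"
      by (simp add: K_def algebra_simps)
    finally show "cmod t / cmod c \<le> K * norm w" .
  qed
  then show ?thesis
    using K by blast
qed

end

section \<open>Convergence of PLMR\<close>

lemma vec_angle_smult: "\<beta> \<noteq> 0 \<Longrightarrow> vec_angle x (\<beta> *s y) = vec_angle x y"
  by (simp add: vec_angle_def cip_smult_right norm_smult norm_mult mult.left_commute)

context simple_nep
begin

text \<open>The local estimates rewritten in terms of the angle, with constants fixed before the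
  iterate, the preconditioner and the tolerance. \<open>U\<close> may be any set containing the
  Krylov space, which leaves room for the additional search direction.\<close>

lemma plmr_step_error:
  obtains \<eta> K where "\<eta> > 0" "K > 0"
    and "\<And>x. x \<noteq> 0 \<Longrightarrow> sin (vec_angle v x) \<le> \<eta> \<Longrightarrow> \<bar>\<rho> x - lam\<bar> \<le> K * (sin (vec_angle v x))\<^sup>2"
    and "\<And>x \<gamma> c t g. x \<noteq> 0 \<Longrightarrow> sin (vec_angle v x) \<le> \<eta> \<Longrightarrow> generalized_decomp (T' lam) v x \<gamma> c t g \<Longrightarrow>
      cmod t / cmod c \<le> K * sin (vec_angle v x)"
    and "\<And>x M m \<tau> U. x \<noteq> 0 \<Longrightarrow> sin (vec_angle v x) \<le> \<eta> \<Longrightarrow>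
      cip x (T' (\<rho> x) *v (matrix_inv M *v (T' (\<rho> x) *v x))) \<noteq> 0 \<Longrightarrow> 0 \<le> \<tau> \<Longrightarrow>
      gmres_delivers M (T (\<rho> x)) (T' (\<rho> x)) x m \<tau> \<Longrightarrow>
      krylov (m + 1) (stab_prec M (T' (\<rho> x)) x ** T (\<rho> x)) x \<subseteq> U \<Longrightarrow>
      sin (subspace_angle v U) \<le> K * (\<tau> * sin (vec_angle v x) + (sin (vec_angle v x))\<^sup>2) \<and>
      (half_hoelder_at T' lam \<longrightarrow>
        sin (subspace_angle v U) \<le> K * (\<tau> * sin (vec_angle v x) + sin (vec_angle v x) ^ 3))"
proof -
  have V: "norm v > 0" using v_nonzero by simp
  obtain K1 where K1: "K1 > 0" "\<forall>\<^sub>F w in nhds 0. \<bar>\<rho> (v + w) - lam\<bar> \<le> K1 * (norm w)\<^sup>2"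
  proof -
    obtain K where K: "K > 0" and "\<forall>\<^sub>F w in nhds 0. v + w \<noteq> 0 \<and>
       \<bar>\<rho> (v + w) - lam\<bar> \<le> K * (norm w)\<^sup>2 \<and> norm (T (\<rho> (v + w)) - T lam) \<le> K * \<bar>\<rho> (v + w) - lam\<bar>"
      using rho_error by blast
    then have "\<forall>\<^sub>F w in nhds 0. \<bar>\<rho> (v + w) - lam\<bar> \<le> K * (norm w)\<^sup>2"
      by (auto elim: eventually_mono)
    with K show ?thesis by (rule that)
  qed
  obtain K2 where K2: "K2 > 0" "\<forall>\<^sub>F w in nhds 0. norm (T (\<rho> (v + w)) *v (v + w)) \<le> K2 * norm w \<and>
     norm (T (\<rho> (v + w)) *v v) \<le> K2 * (norm w)\<^sup>2"
    using residual_error by blast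
  \<comment> \<open>The Hoelder condition sits inside the neighbourhood statement so that one radius
    \<open>d\<close> serves both orders; without the condition any positive constant will
    do.\<close>
  obtain K3 where K3: "K3 > 0" "\<forall>\<^sub>F w in nhds 0. half_hoelder_at T' lam \<longrightarrow>
     norm (T (\<rho> (v + w)) *v v -
       complex_of_real (\<rho> (v + w) - lam) *s (T' (\<rho> (v + w)) *v (v + w))) \<le> K3 * (norm w) ^ 3"
  proof (cases "half_hoelder_at T' lam")
    case True
    then show ?thesis using hoelder_residual_error that by auto
  next
    case False
    then show ?thesis using that[of 1] by simp
  qed
  obtain K4 where K4: "K4 > 0" "\<forall>\<^sub>F w in nhds 0. \<forall>y q \<alpha> \<beta>.
     (let x = v + w; \<mu> = \<rho> x in
       T \<mu> *v y = q + \<alpha> *s (T' \<mu> *v x) \<longrightarrow> cip x (T' \<mu> *v y) = cip x (T' \<mu> *v x) \<longrightarrow>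
       y \<noteq> 0 \<and> sin (vec_angle v y) \<le> K4 * (norm q + norm (T \<mu> *v v - \<beta> *s (T' \<mu> *v x))))"
    using update_error by blast
  obtain K5 where K5: "K5 > 0" "\<forall>\<^sub>F w in nhds 0. \<forall>\<beta> \<gamma> c t g. \<beta> \<noteq> 0 \<longrightarrow>
     generalized_decomp (T' lam) v (\<beta> *s (v + w)) \<gamma> c t g \<longrightarrow> cmod t / cmod c \<le> K5 * norm w"
    using generalized_tangent_error by blast
  from eventually_conj[OF K1(2) eventually_conj[OF K2(2) eventually_conj[OF K3(2) eventually_conj[OF K4(2) K5(2)]]]]
  obtain d where d: "d > 0" and "\<And>w. norm w < d \<Longrightarrow>
     \<bar>\<rho> (v + w) - lam\<bar> \<le> K1 * (norm w)\<^sup>2 \<and>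
     (norm (T (\<rho> (v + w)) *v (v + w)) \<le> K2 * norm w \<and> norm (T (\<rho> (v + w)) *v v) \<le> K2 * (norm w)\<^sup>2) \<and>
     (half_hoelder_at T' lam \<longrightarrow> norm (T (\<rho> (v + w)) *v v -
       complex_of_real (\<rho> (v + w) - lam) *s (T' (\<rho> (v + w)) *v (v + w))) \<le> K3 * (norm w) ^ 3) \<and>
     (\<forall>y q \<alpha> \<beta>. (let x = v + w; \<mu> = \<rho> x in
       T \<mu> *v y = q + \<alpha> *s (T' \<mu> *v x) \<longrightarrow> cip x (T' \<mu> *v y) = cip x (T' \<mu> *v x) \<longrightarrow>
       y \<noteq> 0 \<and> sin (vec_angle v y) \<le> K4 * (norm q + norm (T \<mu> *v v - \<beta> *s (T' \<mu> *v x))))) \<and>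
     (\<forall>\<beta> \<gamma> c t g. \<beta> \<noteq> 0 \<longrightarrow>
       generalized_decomp (T' lam) v (\<beta> *s (v + w)) \<gamma> c t g \<longrightarrow> cmod t / cmod c \<le> K5 * norm w)"
    unfolding eventually_nhds_metric dist_norm diff_zero by blast
  note loc = this(2)
  define A where "A = 2 * norm v"
  have A: "A > 0" using V by (simp add: A_def)
  \<comment> \<open>The bound 1/2 is what the decomposition of \<open>x\<close> requires, and
    \<open>d / (2 * A)\<close> keeps \<open>w\<close> inside the radius \<open>d\<close>.\<close>
  define \<eta> where "\<eta> = min (1 / 2) (d / (2 * A))"
  have \<eta>: "\<eta> > 0" "\<eta> \<le> 1 / 2" "A * \<eta> < d"
  proof -
    have "A * \<eta> \<le> A * (d / (2 * A))"
      using A by (intro mult_left_mono) (auto simp: \<eta>_def)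
    then show "A * \<eta> < d" using A d by simp
  qed (use A d in \<open>auto simp: \<eta>_def\<close>)
  \<comment> \<open>The sum of the positive coefficients of all the estimates dominates each of
    them.\<close>
  define K where "K = K1 * A\<^sup>2 + K5 * A + K4 * K2 * A + K4 * K2 * A\<^sup>2 + K4 * K3 * A ^ 3"
  have pos: "K1 * A\<^sup>2 > 0" "K5 * A > 0" "K4 * K2 * A > 0" "K4 * K2 * A\<^sup>2 > 0" "K4 * K3 * A ^ 3 > 0"
    using A K1(1) K2(1) K3(1) K4(1) K5(1) by simp_all
  then have K: "K > 0" "K1 * A\<^sup>2 \<le> K" "K5 * A \<le> K" "K4 * K2 * A \<le> K" "K4 * K2 * A\<^sup>2 \<le> K" "K4 * K3 * A ^ 3 \<le> K"
    by (simp_all add: K_def)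
  have decomp: "\<exists>\<beta> w. \<beta> \<noteq> 0 \<and> x = \<beta> *s (v + w) \<and> norm w \<le> A * sin (vec_angle v x) \<and> norm w < d"
    if x: "x \<noteq> 0" "sin (vec_angle v x) \<le> \<eta>" for x
  proof -
    obtain \<beta> w where *: "\<beta> \<noteq> 0" "x = \<beta> *s (v + w)" "norm w \<le> A * sin (vec_angle v x)"
      using vec_angle_small_decomp[OF v_nonzero x(1)] x(2) \<eta>(2) unfolding A_def by (metis order_trans)
    have "A * sin (vec_angle v x) \<le> A * \<eta>"
      using A x by (intro mult_left_mono) auto
    then show ?thesis
      using * \<eta>(3) by (intro exI[of _ \<beta>] exI[of _ w]) auto
  qed
  show ?thesis
  proof (rule that[OF \<eta>(1) K(1)])
    fix x :: "complex ^ 'n"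
    let ?e = "sin (vec_angle v x)"
    assume x: "x \<noteq> 0" "?e \<le> \<eta>"
    obtain \<beta> w where w: "\<beta> \<noteq> 0" "x = \<beta> *s (v + w)" "norm w \<le> A * ?e" "norm w < d"
      using decomp[OF x] by blast
    have vw: "v + w \<noteq> 0" using x(1) w(2) by (metis vector_smult_rzero)
    have "\<bar>\<rho> x - lam\<bar> \<le> K1 * (norm w)\<^sup>2"
      using loc[OF w(4)] rho_smult[OF w(1) vw] w(2) by simp
    also have "\<dots> \<le> K1 * (A * ?e)\<^sup>2"
      using K1(1) w(3) by (intro mult_left_mono power_mono) auto
    also have "\<dots> = (K1 * A\<^sup>2) * ?e\<^sup>2"
      by (simp add: power_mult_distrib)
    also have "\<dots> \<le> K * ?e\<^sup>2"
      by (intro mult_right_mono K) auto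
    finally show "\<bar>\<rho> x - lam\<bar> \<le> K * ?e\<^sup>2" .
  next
    fix x g :: "complex ^ 'n" and \<gamma> c t
    let ?e = "sin (vec_angle v x)"
    assume x: "x \<noteq> 0" "?e \<le> \<eta>" and dec: "generalized_decomp (T' lam) v x \<gamma> c t g"
    obtain \<beta> w where w: "\<beta> \<noteq> 0" "x = \<beta> *s (v + w)" "norm w \<le> A * ?e" "norm w < d"
      using decomp[OF x] by blast
    have "cmod t / cmod c \<le> K5 * norm w"
      using loc[OF w(4)] dec w(1,2) by blast
    also have "\<dots> \<le> K5 * (A * ?e)"
      using K5(1) w(3) by (intro mult_left_mono) auto
    also have "\<dots> \<le> K * ?e"
      using mult_right_mono[OF K(3), of ?e] by (simp add: sin_vec_angle_nonneg mult.assoc)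
    finally show "cmod t / cmod c \<le> K * ?e" .
  next
    fix x :: "complex ^ 'n" and M :: "complex ^ 'n ^ 'n" and m \<tau> U
    let ?e = "sin (vec_angle v x)" and ?\<mu> = "\<rho> x"
    assume x: "x \<noteq> 0" "?e \<le> \<eta>"
      and ne: "cip x (T' ?\<mu> *v (matrix_inv M *v (T' ?\<mu> *v x))) \<noteq> 0" and \<tau>: "0 \<le> \<tau>"
      and gm: "gmres_delivers M (T ?\<mu>) (T' ?\<mu>) x m \<tau>"
      and U: "krylov (m + 1) (stab_prec M (T' ?\<mu>) x ** T ?\<mu>) x \<subseteq> U"
    obtain \<beta> w where w: "\<beta> \<noteq> 0" "x = \<beta> *s (v + w)" "norm w \<le> A * ?e" "norm w < d"
      using decomp[OF x] by blast
    let ?z = "v + w"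
    have z0: "?z \<noteq> 0" using x(1) w(2) by (metis vector_smult_rzero)
    have \<mu>: "\<rho> ?z = ?\<mu>" using rho_smult[OF w(1) z0] w(2) by simp
    have e0: "0 \<le> ?e" by (rule sin_vec_angle_nonneg)
    obtain y q \<alpha> where y: "y \<in> U" "T ?\<mu> *v y = q + \<alpha> *s (T' ?\<mu> *v x)"
      "cip x (T' ?\<mu> *v y) = cip x (T' ?\<mu> *v x)" "norm q \<le> \<tau> * norm (T ?\<mu> *v x)"
      using gmres_delivers_update[OF hermitian_T'[OF rho_in[OF x(1)]] ne rho_root[OF x(1)] gm] U by blast
    \<comment> \<open>The bordered system is homogeneous: dividing by \<open>\<beta>\<close> turns
      \<open>x\<close> into \<open>v + w\<close> and leaves \<open>\<alpha>\<close>
      unchanged.\<close>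
    define y' q' where "y' = (1 / \<beta>) *s y" and "q' = (1 / \<beta>) *s q"
    have "y = \<beta> *s y'"
      using w(1) by (simp add: y'_def vector_smult_assoc)
    then have Dy: "T' ?\<mu> *v y = \<beta> *s (T' ?\<mu> *v y')"
      by (simp only: matrix_vector_mult_smult)
    have Dx: "T' ?\<mu> *v x = \<beta> *s (T' ?\<mu> *v ?z)"
      by (simp only: w(2) matrix_vector_mult_smult)
    have cx: "cip x u = cnj \<beta> * cip ?z u" for u
      by (simp only: w(2) cip_smult_left)
    have "cip ?z (T' ?\<mu> *v y') = cip ?z (T' ?\<mu> *v ?z)"
      using y(3) w(1) unfolding Dx Dy cx cip_smult_right by simp
    moreover have "T ?\<mu> *v y' = q' + \<alpha> *s (T' ?\<mu> *v ?z)"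
      using w(1) by (simp add: y'_def q'_def matrix_vector_mult_smult y(2) Dx vec_eq_iff field_simps)
    ultimately have upd: "y' \<noteq> 0 \<and>
        sin (vec_angle v y') \<le> K4 * (norm q' + norm (T ?\<mu> *v v - \<beta>' *s (T' ?\<mu> *v ?z)))" for \<beta>'
      using loc[OF w(4)] unfolding Let_def \<mu> by blast
    have "norm q' = norm q / cmod \<beta>"
      by (simp add: q'_def norm_smult norm_divide)
    also have "\<dots> \<le> (\<tau> * norm (T ?\<mu> *v x)) / cmod \<beta>"
      by (intro divide_right_mono y) auto
    also have "norm (T ?\<mu> *v x) = cmod \<beta> * norm (T ?\<mu> *v ?z)"
      by (simp only: w(2) matrix_vector_mult_smult norm_smult)
    also have "(\<tau> * (cmod \<beta> * norm (T ?\<mu> *v ?z))) / cmod \<beta> = \<tau> * norm (T ?\<mu> *v ?z)"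
      using w(1) by simp
    also have "\<dots> \<le> \<tau> * (K2 * norm w)"
      using loc[OF w(4)] \<tau> unfolding \<mu> by (intro mult_left_mono) auto
    also have "\<dots> \<le> \<tau> * (K2 * (A * ?e))"
      using K2(1) w(3) \<tau> by (intro mult_left_mono) auto
    finally have q': "norm q' \<le> \<tau> * (K2 * (A * ?e))" .
    have "sin (subspace_angle v U) \<le> sin (vec_angle v y)"
      using upd y(1) by (intro sin_subspace_angle_le) (auto simp: y'_def)
    also have "\<dots> = sin (vec_angle v y')"
      using w(1) by (simp add: y'_def vec_angle_smult)
    finally have sub: "sin (subspace_angle v U) \<le> K4 * (norm q' + norm (T ?\<mu> *v v - \<beta>' *s (T' ?\<mu> *v ?z)))" for \<beta>'
      using upd[of \<beta>'] by linarith
    \<comment> \<open>One computation for both orders: \<open>j\<close> will be 2 or 3, and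
      \<open>\<beta>'\<close> is the free multiple of the border vector.\<close>
    have bound: "sin (subspace_angle v U) \<le> K * (\<tau> * ?e + ?e ^ j)"
      if E: "norm (T ?\<mu> *v v - \<beta>' *s (T' ?\<mu> *v ?z)) \<le> L * (norm w) ^ j" and L: "0 < L" "K4 * L * A ^ j \<le> K"
      for \<beta>' L j
    proof -
      have "L * (norm w) ^ j \<le> L * (A * ?e) ^ j"
        using w(3) L(1) by (intro mult_left_mono power_mono) auto
      then have "sin (subspace_angle v U) \<le> K4 * (\<tau> * (K2 * (A * ?e)) + L * (A * ?e) ^ j)"
        using q' E K4(1) by (intro order_trans[OF sub[of \<beta>']] mult_left_mono add_mono) auto
      also have "\<dots> = (K4 * K2 * A) * (\<tau> * ?e) + (K4 * L * A ^ j) * ?e ^ j"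
        by (simp add: power_mult_distrib algebra_simps)
      also have "\<dots> \<le> K * (\<tau> * ?e) + K * ?e ^ j"
        using \<tau> e0 by (intro add_mono mult_right_mono K L) auto
      finally show ?thesis
        by (simp add: algebra_simps)
    qed
    \<comment> \<open>With the multiple 0 the error is the residual of \<open>v\<close>, which is
      quadratic.\<close>
    have "sin (subspace_angle v U) \<le> K * (\<tau> * ?e + ?e\<^sup>2)"
      by (rule bound[of 0 K2]) (use loc[OF w(4)] K(5) K2(1) \<mu> in auto)
    \<comment> \<open>The multiple \<open>?\<mu> - lam\<close> makes the error cubic under the
      Hoelder condition.\<close>
    moreover have "sin (subspace_angle v U) \<le> K * (\<tau> * ?e + ?e ^ 3)" if "half_hoelder_at T' lam"
      by (rule bound[of "complex_of_real (?\<mu> - lam)" K3]) (use loc[OF w(4)] K(6) K3(1) \<mu> that in auto)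
    ultimately show "sin (subspace_angle v U) \<le> K * (\<tau> * ?e + ?e\<^sup>2) \<and>
        (half_hoelder_at T' lam \<longrightarrow> sin (subspace_angle v U) \<le> K * (\<tau> * ?e + ?e ^ 3))"
      by blast
  qed
qed

end

section \<open>Contraction and the convergence orders\<close>

text \<open>Halving is known only below \<open>\<eta>\<close>. Induction carries the bound by
  \<open>\<eta>\<close> along with the geometric decay, so the iteration never leaves the region
  where the step estimate holds.\<close>

lemma local_contraction:
  fixes e :: "nat \<Rightarrow> real"
  assumes "\<And>k. 0 \<le> e k" "e 0 \<le> \<eta>" and step: "\<And>k. e k \<le> \<eta> \<Longrightarrow> e (Suc k) \<le> e k / 2"
  shows "e k \<le> \<eta>" and "e \<longlonglongrightarrow> 0"
proof -
  have *: "e k \<le> \<eta> \<and> e k \<le> e 0 * (1 / 2) ^ k" for k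
  proof (induction k)
    case (Suc k)
    then show ?case
      using step[of k] assms(1)[of k] by auto
  qed (use assms in auto)
  show "e k \<le> \<eta>" using * by blast
  have "(\<lambda>k. e 0 * (1 / 2) ^ k) \<longlonglongrightarrow> e 0 * 0"
    by (intro tendsto_mult tendsto_const LIMSEQ_power_zero) auto
  then have "(\<lambda>k. e 0 * (1 / 2) ^ k) \<longlonglongrightarrow> 0"
    by simp
  then show "e \<longlonglongrightarrow> 0"
    by (rule Lim_null_comparison[rotated]) (use * assms(1) in simp)
qed

text \<open>"Sufficiently small" is expressed by thresholds that precede the sequences of
  parameters, iterates and decompositions, so one choice serves every run.\<close>

theorem theorem4p2:
  fixes a b lam \<sigma> \<delta> \<xi> C :: real
    and T T' :: "real \<Rightarrow> complex ^ 'n ^ 'n"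
    and \<rho> :: "complex ^ 'n \<Rightarrow> real"
    and v :: "complex ^ 'n"
    and M :: "complex ^ 'n ^ 'n"
    and r s :: nat
  assumes "hermitian_nep a b T T'"
    and "rayleigh_functional a b T \<rho>"
    and "definite_type a b T \<rho>"
    and "simple_eigenpair a b T lam v"
    and "cip v (T' lam *v v) = 1"
    and "\<sigma> \<in> {a<..<b}"
    and "\<And>\<mu> w. eigenpair a b T \<mu> w \<Longrightarrow> \<bar>lam - \<sigma>\<bar> \<le> \<bar>\<mu> - \<sigma>\<bar>"
    and "invertible M"
    and "r > 0" and "s > 0"
    and "\<delta> > 0" and "\<xi> > 0"
    and "\<And>\<mu> x. \<mu> \<in> {a<..<b} \<Longrightarrow> norm ((x, \<mu>) - (v, lam)) \<le> \<delta> \<Longrightarrow> norm (T' \<mu> *v x) \<le> \<xi>"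
    and "C > 0"
  shows "\<exists>\<eta>>0. \<exists>\<tau>_max>0. \<exists>C\<beta>_max>0. \<exists>C\<gamma>_max>0.
    \<forall>(m :: nat \<Rightarrow> nat) (x :: nat \<Rightarrow> complex ^ 'n) (\<gamma> :: nat \<Rightarrow> real)
      (c :: nat \<Rightarrow> complex) (t :: nat \<Rightarrow> complex) (g :: nat \<Rightarrow> complex ^ 'n).
      plmr_sequence a b T T' \<rho> M \<sigma> r s m x \<and>
      (\<forall>k. generalized_decomp (T' lam) v (x k) (\<gamma> k) (c k) (t k) (g k)) \<and>
      vec_angle (x 0) v \<le> \<eta> \<and>
      norm ((x 0, \<rho> (x 0)) - (v, lam)) \<le> \<delta> \<and>
      (\<forall>k. sin (vec_angle v (x (Suc k))) \<le> C * sin (subspace_angle v (plmr_space T T' \<rho> M m x k)))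
      \<longrightarrow>
      (\<forall>\<tau>0. 0 < \<tau>0 \<and> \<tau>0 \<le> \<tau>_max \<and>
         (\<forall>k. gmres_delivers M (T (\<rho> (x k))) (T' (\<rho> (x k))) (x k) (m k) \<tau>0)
         \<longrightarrow> at_least_linearly (\<lambda>k. sin (vec_angle v (x k))) \<and> (\<lambda>k. \<rho> (x k)) \<longlonglongrightarrow> lam) \<and>
      (\<forall>C\<beta> \<tau>. 0 < C\<beta> \<and> C\<beta> \<le> C\<beta>_max \<and> decseq \<tau> \<and>
         (\<forall>k. 0 \<le> \<tau> k \<and> \<tau> k \<le> C\<beta> * (cmod (t k) / cmod (c k))) \<and>
         (\<forall>k. gmres_delivers M (T (\<rho> (x k))) (T' (\<rho> (x k))) (x k) (m k) (\<tau> k))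
         \<longrightarrow> at_least_quadratically (\<lambda>k. sin (vec_angle v (x k))) \<and> (\<lambda>k. \<rho> (x k)) \<longlonglongrightarrow> lam) \<and>
      (\<forall>C\<gamma> \<tau>. 0 < C\<gamma> \<and> C\<gamma> \<le> C\<gamma>_max \<and> decseq \<tau> \<and>
         (\<forall>k. 0 \<le> \<tau> k \<and> \<tau> k \<le> C\<gamma> * ((cmod (t k))\<^sup>2 / (cmod (c k))\<^sup>2)) \<and>
         (\<forall>k. gmres_delivers M (T (\<rho> (x k))) (T' (\<rho> (x k))) (x k) (m k) (\<tau> k)) \<and>
         half_hoelder_at T' lam
         \<longrightarrow> at_least_cubically (\<lambda>k. sin (vec_angle v (x k))) \<and> (\<lambda>k. \<rho> (x k)) \<longlonglongrightarrow> lam)"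
proof -
  interpret simple_nep a b lam T T' \<rho> v
    by unfold_locales (use assms in auto)
  obtain \<eta>0 K where \<eta>0: "\<eta>0 > 0" and K: "K > 0"
    and rho: "\<And>x. x \<noteq> 0 \<Longrightarrow> sin (vec_angle v x) \<le> \<eta>0 \<Longrightarrow> \<bar>\<rho> x - lam\<bar> \<le> K * (sin (vec_angle v x))\<^sup>2"
    and tangent: "\<And>x \<gamma> c t g. x \<noteq> 0 \<Longrightarrow> sin (vec_angle v x) \<le> \<eta>0 \<Longrightarrow>
      generalized_decomp (T' lam) v x \<gamma> c t g \<Longrightarrow> cmod t / cmod c \<le> K * sin (vec_angle v x)"
    and gmres: "\<And>x M m \<tau> U. x \<noteq> 0 \<Longrightarrow> sin (vec_angle v x) \<le> \<eta>0 \<Longrightarrow>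
      cip x (T' (\<rho> x) *v (matrix_inv M *v (T' (\<rho> x) *v x))) \<noteq> 0 \<Longrightarrow> 0 \<le> \<tau> \<Longrightarrow>
      gmres_delivers M (T (\<rho> x)) (T' (\<rho> x)) x m \<tau> \<Longrightarrow>
      krylov (m + 1) (stab_prec M (T' (\<rho> x)) x ** T (\<rho> x)) x \<subseteq> U \<Longrightarrow>
      sin (subspace_angle v U) \<le> K * (\<tau> * sin (vec_angle v x) + (sin (vec_angle v x))\<^sup>2) \<and>
      (half_hoelder_at T' lam \<longrightarrow>
        sin (subspace_angle v U) \<le> K * (\<tau> * sin (vec_angle v x) + sin (vec_angle v x) ^ 3))"
    using plmr_step_error by blast
  \<comment> \<open>The extraction constant times the constant for the angle to the search
    space.\<close>
  define B where "B = C * K"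
  have B: "B > 0" using K \<open>C > 0\<close> by (simp add: B_def)
  \<comment> \<open>Dominates the factors 1, \<open>1 + K\<close> and \<open>1 + K\<^sup>2\<close>
    of the linear, quadratic and cubic cases, so that one \<open>\<eta>\<close> works for all
    three.\<close>
  define L where "L = 1 + K + K\<^sup>2"
  have L: "L > 0" "1 \<le> L" "1 + K \<le> L" "1 + K\<^sup>2 \<le> L" using K by (auto simp: L_def add_pos_pos)
  define \<eta> where "\<eta> = Min {\<eta>0, 1, 1 / (4 * B * L)}"
  have \<eta>: "\<eta> > 0" "\<eta> \<le> \<eta>0" "\<eta> \<le> 1" "\<eta> \<le> 1 / (4 * B * L)"
    using \<eta>0 B L by (auto simp: \<eta>_def)
  have B\<eta>: "B * L * \<eta> \<le> 1 / 4"
  proof -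
    have "B * L * \<eta> \<le> B * L * (1 / (4 * B * L))"
      using B L by (intro mult_left_mono \<eta>) auto
    then show ?thesis using B L by simp
  qed
  \<comment> \<open>A fixed tolerance must itself contract, whence \<open>1 / (4 * B)\<close>. The
    other two tolerances shrink with the error; smallness then comes from \<open>\<eta>\<close>, and
    the threshold 1 suffices.\<close>
  have main: "
      (\<forall>\<tau>0. 0 < \<tau>0 \<and> \<tau>0 \<le> 1 / (4 * B) \<and>
         (\<forall>k. gmres_delivers M (T (\<rho> (x k))) (T' (\<rho> (x k))) (x k) (m k) \<tau>0)
         \<longrightarrow> at_least_linearly (\<lambda>k. sin (vec_angle v (x k))) \<and> (\<lambda>k. \<rho> (x k)) \<longlonglongrightarrow> lam) \<and>
      (\<forall>C\<beta> \<tau>. 0 < C\<beta> \<and> C\<beta> \<le> 1 \<and> decseq \<tau> \<and>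
         (\<forall>k. 0 \<le> \<tau> k \<and> \<tau> k \<le> C\<beta> * (cmod (t k) / cmod (c k))) \<and>
         (\<forall>k. gmres_delivers M (T (\<rho> (x k))) (T' (\<rho> (x k))) (x k) (m k) (\<tau> k))
         \<longrightarrow> at_least_quadratically (\<lambda>k. sin (vec_angle v (x k))) \<and> (\<lambda>k. \<rho> (x k)) \<longlonglongrightarrow> lam) \<and>
      (\<forall>C\<gamma> \<tau>. 0 < C\<gamma> \<and> C\<gamma> \<le> 1 \<and> decseq \<tau> \<and>
         (\<forall>k. 0 \<le> \<tau> k \<and> \<tau> k \<le> C\<gamma> * ((cmod (t k))\<^sup>2 / (cmod (c k))\<^sup>2)) \<and>
         (\<forall>k. gmres_delivers M (T (\<rho> (x k))) (T' (\<rho> (x k))) (x k) (m k) (\<tau> k)) \<and>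
         half_hoelder_at T' lam
         \<longrightarrow> at_least_cubically (\<lambda>k. sin (vec_angle v (x k))) \<and> (\<lambda>k. \<rho> (x k)) \<longlonglongrightarrow> lam)"
    if plmr: "plmr_sequence a b T T' \<rho> M \<sigma> r s m x"
      and dec: "\<And>k. generalized_decomp (T' lam) v (x k) (\<gamma> k) (c k) (t k) (g k)"
      and start: "vec_angle (x 0) v \<le> \<eta>"
      and refined: "\<And>k. sin (vec_angle v (x (Suc k))) \<le> C * sin (subspace_angle v (plmr_space T T' \<rho> M m x k))"
    for m :: "nat \<Rightarrow> nat" and x :: "nat \<Rightarrow> complex ^ 'n" and \<gamma> c t g
  proof -
    define e where "e = (\<lambda>k. sin (vec_angle v (x k)))"
    have e0: "0 \<le> e k" for k
      by (simp add: e_def sin_vec_angle_nonneg)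
    \<comment> \<open>A zero iterate would make the denominator of the projector vanish.\<close>
    have x0: "x k \<noteq> 0" for k
      using plmr by (auto simp: plmr_sequence_def Let_def) (metis cip_zero_left)
    have ne: "cip (x k) (T' (\<rho> (x k)) *v (matrix_inv M *v (T' (\<rho> (x k)) *v x k))) \<noteq> 0" for k
      using plmr by (auto simp: plmr_sequence_def Let_def)
    have start': "e 0 \<le> \<eta>"
      unfolding e_def vec_angle_commute[of v] using start vec_angle_nonneg[of "x 0" v]
      by (intro order_trans[OF sin_x_le_x]) auto
    \<comment> \<open>The component along the previous direction is taken to be 0, which also covers
      \<open>k = 0\<close>.\<close>
    have sub: "krylov (m k + 1) (stab_prec M (T' (\<rho> (x k))) (x k) ** T (\<rho> (x k))) (x k)
        \<subseteq> plmr_space T T' \<rho> M m x k" for k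
      unfolding plmr_space_def by (force intro: vec.span_zero)
    have step: "e (Suc k) \<le> B * (\<tau> * e k + (e k)\<^sup>2)"
      "half_hoelder_at T' lam \<Longrightarrow> e (Suc k) \<le> B * (\<tau> * e k + e k ^ 3)"
      if "e k \<le> \<eta>" "0 \<le> \<tau>" "gmres_delivers M (T (\<rho> (x k))) (T' (\<rho> (x k))) (x k) (m k) \<tau>" for k \<tau>
    proof -
      let ?s = "sin (subspace_angle v (plmr_space T T' \<rho> M m x k))"
      have le: "e k \<le> \<eta>0" using that \<eta> by simp
      have s1: "?s \<le> K * (\<tau> * e k + (e k)\<^sup>2)" and s2: "half_hoelder_at T' lam \<Longrightarrow> ?s \<le> K * (\<tau> * e k + e k ^ 3)"
        unfolding e_def using gmres[OF x0 le[unfolded e_def] ne that(2,3) sub] by blast+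
      have ext: "e (Suc k) \<le> C * ?s" by (simp add: e_def refined)
      show "e (Suc k) \<le> B * (\<tau> * e k + (e k)\<^sup>2)"
        using order_trans[OF ext mult_left_mono[OF s1]] \<open>C > 0\<close> by (simp add: B_def mult.assoc)
      show "e (Suc k) \<le> B * (\<tau> * e k + e k ^ 3)" if "half_hoelder_at T' lam"
        using order_trans[OF ext mult_left_mono[OF s2[OF that]]] \<open>C > 0\<close> by (simp add: B_def mult.assoc)
    qed
    have tan: "cmod (t k) / cmod (c k) \<le> K * e k" if "e k \<le> \<eta>" for k
      unfolding e_def by (rule tangent[OF x0 _ dec]) (use that \<eta> in \<open>auto simp: e_def\<close>)
    have small: "B * L' * e k \<le> 1 / 4" if "e k \<le> \<eta>" "0 \<le> L'" "L' \<le> L" for k L'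
    proof -
      have "B * L' * e k \<le> B * L * \<eta>"
        using that B e0 L by (intro mult_mono) auto
      then show ?thesis using B\<eta> by simp
    qed
    have rho_lim: "(\<lambda>k. \<rho> (x k)) \<longlonglongrightarrow> lam" if le: "\<And>k. e k \<le> \<eta>" and lim: "e \<longlonglongrightarrow> 0"
    proof -
      have "(\<lambda>k. K * (e k)\<^sup>2) \<longlonglongrightarrow> K * 0\<^sup>2"
        by (intro tendsto_intros lim)
      then have lim': "(\<lambda>k. K * (e k)\<^sup>2) \<longlonglongrightarrow> 0"
        by simp
      have "\<bar>\<rho> (x k) - lam\<bar> \<le> K * (e k)\<^sup>2" for k
        unfolding e_def by (rule rho[OF x0]) (use le[of k] \<eta>(2) in \<open>simp add: e_def\<close>)
      then have "(\<lambda>k. \<rho> (x k) - lam) \<longlonglongrightarrow> 0"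
        by (intro Lim_null_comparison[OF _ lim']) simp
      then show ?thesis by (simp add: LIM_zero_iff)
    qed
    have linear: "at_least_linearly e \<and> (\<lambda>k. \<rho> (x k)) \<longlonglongrightarrow> lam"
      if \<tau>0: "0 < \<tau>0" "\<tau>0 \<le> 1 / (4 * B)"
        and gm: "\<And>k. gmres_delivers M (T (\<rho> (x k))) (T' (\<rho> (x k))) (x k) (m k) \<tau>0" for \<tau>0
    proof -
      have half: "e (Suc k) \<le> e k / 2" if "e k \<le> \<eta>" for k
      proof -
        \<comment> \<open>The tolerance and the quadratic term contribute at most a quarter
          each.\<close>
        have "B * \<tau>0 \<le> 1 / 4" using \<tau>0 B by (simp add: field_simps)
        moreover have "B * e k \<le> 1 / 4" using small[of k 1] that L by simp
        ultimately have "(B * \<tau>0 + B * e k) * e k \<le> (1 / 4 + 1 / 4) * e k"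
          by (intro mult_right_mono add_mono e0)
        then show ?thesis
          using step(1)[OF that _ gm] \<tau>0 by (simp add: power2_eq_square algebra_simps)
      qed
      note le = local_contraction(1)[of e, OF e0 start' half] and lim = local_contraction(2)[of e, OF e0 start' half]
      have "at_least_linearly e"
        unfolding at_least_linearly_def using half[OF le] lim by (intro conjI exI[of _ "1 / 2"]) auto
      then show ?thesis using rho_lim le lim by blast
    qed
    \<comment> \<open>The quadratic and cubic cases together: \<open>j\<close> is the order minus
      one, and the tolerance is bounded by the \<open>j\<close>-th power of the tangent
      bound.\<close>
    have higher: "e (Suc k) \<le> B * (1 + K ^ j) * (e k * e k ^ j)" "e (Suc k) \<le> e k / 2"
      if "e k \<le> \<eta>" and "e (Suc k) \<le> B * (\<tau> * e k + e k * e k ^ j)" "\<tau> \<le> (K * e k) ^ j" "j \<in> {1, 2}" for k j \<tau>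
    proof -
      have "\<tau> * e k + e k * e k ^ j \<le> (K * e k) ^ j * e k + e k * e k ^ j"
        using that e0 by (intro add_right_mono mult_right_mono) auto
      also have "\<dots> = (1 + K ^ j) * (e k * e k ^ j)"
        by (simp add: power_mult_distrib algebra_simps)
      finally have "B * (\<tau> * e k + e k * e k ^ j) \<le> B * ((1 + K ^ j) * (e k * e k ^ j))"
        using B by (intro mult_left_mono) auto
      then show 1: "e (Suc k) \<le> B * (1 + K ^ j) * (e k * e k ^ j)"
        using that(2) by (simp add: mult.assoc)
      \<comment> \<open>Because \<open>\<eta>\<close> is at most 1, one factor \<open>e k\<close>
        can replace the power, and \<open>small\<close> then gives the halving.\<close>
      have "e k ^ j \<le> e k"
        using that(1,4) \<eta>(3) e0[of k] by (auto simp: power2_eq_square mult_left_le)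
      then have "B * (1 + K ^ j) * (e k * e k ^ j) \<le> B * (1 + K ^ j) * (e k * e k)"
        using B K e0 by (intro mult_left_mono) auto
      also have "\<dots> = (B * (1 + K ^ j) * e k) * e k"
        by simp
      also have "\<dots> \<le> (1 / 4) * e k"
        using K L that(4) by (intro mult_right_mono e0 small that) auto
      finally show "e (Suc k) \<le> e k / 2"
        using 1 e0[of k] by linarith
    qed
    have quadratic: "at_least_quadratically e \<and> (\<lambda>k. \<rho> (x k)) \<longlonglongrightarrow> lam"
      if C\<beta>: "0 < C\<beta>" "C\<beta> \<le> 1" and \<tau>: "\<And>k. 0 \<le> \<tau> k" "\<And>k. \<tau> k \<le> C\<beta> * (cmod (t k) / cmod (c k))"
        and gm: "\<And>k. gmres_delivers M (T (\<rho> (x k))) (T' (\<rho> (x k))) (x k) (m k) (\<tau> k)" for C\<beta> \<tau>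
    proof -
      have \<tau>': "\<tau> k \<le> (K * e k) ^ 1" if "e k \<le> \<eta>" for k
      proof -
        have "C\<beta> * (cmod (t k) / cmod (c k)) \<le> 1 * (K * e k)"
          using C\<beta> tan[OF that] by (intro mult_mono) auto
        then show ?thesis using \<tau>(2)[of k] by simp
      qed
      have st: "e (Suc k) \<le> B * (\<tau> k * e k + e k * e k ^ 1)" if "e k \<le> \<eta>" for k
        using step(1)[OF that \<tau>(1) gm] by (simp add: power2_eq_square)
      have half: "e (Suc k) \<le> e k / 2" if "e k \<le> \<eta>" for k
        using higher(2)[OF that st[OF that] \<tau>'[OF that]] by simp
      note le = local_contraction(1)[of e, OF e0 start' half] and lim = local_contraction(2)[of e, OF e0 start' half]
      have "e (Suc k) \<le> (B * (1 + K ^ 1)) * (e k)\<^sup>2" for k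
        using higher(1)[OF le st[OF le] \<tau>'[OF le]] by (simp add: power2_eq_square)
      then have "at_least_quadratically e"
        unfolding at_least_quadratically_def using lim by blast
      then show ?thesis using rho_lim le lim by blast
    qed
    have cubic: "at_least_cubically e \<and> (\<lambda>k. \<rho> (x k)) \<longlonglongrightarrow> lam"
      if C\<gamma>: "0 < C\<gamma>" "C\<gamma> \<le> 1" and \<tau>: "\<And>k. 0 \<le> \<tau> k" "\<And>k. \<tau> k \<le> C\<gamma> * ((cmod (t k))\<^sup>2 / (cmod (c k))\<^sup>2)"
        and gm: "\<And>k. gmres_delivers M (T (\<rho> (x k))) (T' (\<rho> (x k))) (x k) (m k) (\<tau> k)"
        and hoelder: "half_hoelder_at T' lam" for C\<gamma> \<tau>
    proof -
      have \<tau>': "\<tau> k \<le> (K * e k) ^ 2" if "e k \<le> \<eta>" for k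
      proof -
        have "C\<gamma> * ((cmod (t k))\<^sup>2 / (cmod (c k))\<^sup>2) \<le> 1 * (K * e k)\<^sup>2"
          unfolding power_divide[symmetric] using C\<gamma> tan[OF that] by (intro mult_mono power_mono) auto
        then show ?thesis using \<tau>(2)[of k] by simp
      qed
      have st: "e (Suc k) \<le> B * (\<tau> k * e k + e k * e k ^ 2)" if "e k \<le> \<eta>" for k
        using step(2)[OF that \<tau>(1) gm hoelder] by (simp add: power2_eq_square power3_eq_cube mult.assoc)
      have half: "e (Suc k) \<le> e k / 2" if "e k \<le> \<eta>" for k
        using higher(2)[OF that st[OF that] \<tau>'[OF that]] by simp
      note le = local_contraction(1)[of e, OF e0 start' half] and lim = local_contraction(2)[of e, OF e0 start' half]
      have "e (Suc k) \<le> (B * (1 + K ^ 2)) * e k ^ 3" for k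
        using higher(1)[OF le st[OF le] \<tau>'[OF le]] by (simp add: power2_eq_square power3_eq_cube mult.assoc)
      then have "at_least_cubically e"
        unfolding at_least_cubically_def using lim by blast
      then show ?thesis using rho_lim le lim by blast
    qed
    show ?thesis
      unfolding e_def[symmetric] using linear quadratic cubic by blast
  qed
  show ?thesis
    by (rule exI[of _ \<eta>], rule conjI[OF \<eta>(1)], rule exI[of _ "1 / (4 * B)"], rule conjI, use B in simp,
        rule exI[of _ 1], rule conjI, simp, rule exI[of _ 1], rule conjI, simp, intro allI impI, rule main) blast+
qed

end
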